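(* Let $m$ be an odd prime, and let $r$ and $s$ be positive integers such that either $s$ is even, or $s$ is odd and $r$ divides $sm$. Then there is a tight chiral polyhedron of type $\{2rm, s m^2\}$.
   Context: An (abstract) polyhedron is a partially ordered set whose elements have rank $0$, $1$, $2$ (vertices, edges, faces), incidence meaning comparability, such that every edge is incident to exactly two vertices and two faces, whenever a vertex is incident to a face exactly two edges are incident to both, the incidence graph is connected, and for each vertex or face the subgraph of the incidence graph induced on its neighbours is connected. A flag is a mutually incident (vertex, edge, face) triple; $\Phi^i$ is the flag differing from $\Phi$ exactly in its rank-$i$ element. Type $\{p,q\}$: faces are incident to $p$ edges and vertices to $q$ edges. An automorphism is an incidence-preserving bijection. The polyhedron is chiral if its flags split into two classes with $\Phi,\Phi^i$ always in different classes and the automorphism group transitive on each class but not on all flags. A polyhedron of type $\{p,q\}$ is tight if it has exactly $2pq$ flags. *)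

theory Defs
  imports "HOL-Computational_Algebra.Primes"
begin

record 'a ranked_poset =
  elems :: "'a set"
  leq :: "'a rel"
  rk :: "'a \<Rightarrow> nat"

definition of_rank :: "'a ranked_poset \<Rightarrow> nat \<Rightarrow> 'a set" where
  "of_rank P i = {x \<in> elems P. rk P x = i}"

abbreviation vertices :: "'a ranked_poset \<Rightarrow> 'a set" where
  "vertices P \<equiv> of_rank P 0"

abbreviation edges :: "'a ranked_poset \<Rightarrow> 'a set" where
  "edges P \<equiv> of_rank P 1"

abbreviation faces :: "'a ranked_poset \<Rightarrow> 'a set" where
  "faces P \<equiv> of_rank P 2"

text \<open>Incidence is comparability of distinct elements, so that it is the adjacency
  relation of a simple graph, the incidence graph.\<close>

definition incident :: "'a ranked_poset \<Rightarrow> 'a \<Rightarrow> 'a \<Rightarrow> bool" where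
  "incident P x y \<longleftrightarrow> x \<in> elems P \<and> y \<in> elems P \<and> x \<noteq> y \<and> ((x, y) \<in> leq P \<or> (y, x) \<in> leq P)"

definition incidence_neighbours :: "'a ranked_poset \<Rightarrow> 'a \<Rightarrow> 'a set" where
  "incidence_neighbours P x = {y. incident P x y}"

text \<open>Connectedness of the subgraph of the incidence graph induced on \<open>S\<close>;
  the graph without nodes does not count as connected.\<close>

definition incidence_connected :: "'a ranked_poset \<Rightarrow> 'a set \<Rightarrow> bool" where
  "incidence_connected P S \<longleftrightarrow>
     S \<noteq> {} \<and> (\<forall>x\<in>S. \<forall>y\<in>S. (x, y) \<in> {(a, b). a \<in> S \<and> b \<in> S \<and> incident P a b}\<^sup>*)"

definition polyhedron :: "'a ranked_poset \<Rightarrow> bool" where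
  "polyhedron P \<longleftrightarrow>
     partial_order_on (elems P) (leq P) \<and>
     (\<forall>x\<in>elems P. rk P x \<in> {0, 1, 2}) \<and>
     (\<forall>x y. (x, y) \<in> leq P \<and> x \<noteq> y \<longrightarrow> rk P x < rk P y) \<and>
     (\<forall>e\<in>edges P. card {v \<in> vertices P. incident P v e} = 2 \<and>
                    card {f \<in> faces P. incident P e f} = 2) \<and>
     (\<forall>v\<in>vertices P. \<forall>f\<in>faces P. incident P v f \<longrightarrow>
        card {e \<in> edges P. incident P v e \<and> incident P e f} = 2) \<and>
     incidence_connected P (elems P) \<and>
     (\<forall>x \<in> vertices P \<union> faces P. incidence_connected P (incidence_neighbours P x))"

type_synonym 'a flag = "'a \<times> 'a \<times> 'a"

definition flags :: "'a ranked_poset \<Rightarrow> 'a flag set" where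
  "flags P = {(v, e, f). v \<in> vertices P \<and> e \<in> edges P \<and> f \<in> faces P \<and>
                         incident P v e \<and> incident P e f \<and> incident P v f}"

definition flag_elem :: "nat \<Rightarrow> 'a flag \<Rightarrow> 'a" where
  "flag_elem i \<Phi> = (case \<Phi> of (v, e, f) \<Rightarrow> if i = 0 then v else if i = 1 then e else f)"

definition differ_exactly_at :: "nat \<Rightarrow> 'a flag \<Rightarrow> 'a flag \<Rightarrow> bool" where
  "differ_exactly_at i \<Phi> \<Psi> \<longleftrightarrow> (\<forall>j\<in>{0, 1, 2}. flag_elem j \<Phi> \<noteq> flag_elem j \<Psi> \<longleftrightarrow> j = i)"

text \<open>The flag \<open>\<Phi>\<^sup>i\<close>; it is well defined in a polyhedron
  by \<open>ex1_adj_flag\<close> below.\<close>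

definition adj_flag :: "'a ranked_poset \<Rightarrow> nat \<Rightarrow> 'a flag \<Rightarrow> 'a flag" where
  "adj_flag P i \<Phi> = (THE \<Psi>. \<Psi> \<in> flags P \<and> differ_exactly_at i \<Phi> \<Psi>)"

lemma card_2_other:
  assumes "card {x. Q x} = 2" "Q x"
  obtains y where "Q y" "x \<noteq> y" "\<And>z. Q z \<Longrightarrow> x \<noteq> z \<Longrightarrow> z = y"
proof -
  from assms(1) obtain a b where ab: "{x. Q x} = {a, b}" "a \<noteq> b"
    by (auto simp: card_2_iff)
  then have Q: "Q z \<longleftrightarrow> z = a \<or> z = b" for z
    by blast
  show thesis
    using that[of a] that[of b] ab(2) assms(2) unfolding Q by blast
qed

lemma polyhedronD:
  assumes "polyhedron P"
  shows "partial_order_on (elems P) (leq P)"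
    and "(x, y) \<in> leq P \<Longrightarrow> x \<noteq> y \<Longrightarrow> rk P x < rk P y"
    and "e \<in> edges P \<Longrightarrow> card {v \<in> vertices P. incident P v e} = 2"
    and "e \<in> edges P \<Longrightarrow> card {f \<in> faces P. incident P e f} = 2"
    and "v \<in> vertices P \<Longrightarrow> f \<in> faces P \<Longrightarrow> incident P v f \<Longrightarrow>
      card {e \<in> edges P. incident P v e \<and> incident P e f} = 2"
  using assms unfolding polyhedron_def by blast+

lemma incident_leqD:
  assumes "polyhedron P" "incident P x y" "rk P x < rk P y"
  shows "(x, y) \<in> leq P"
  using polyhedronD(2)[OF assms(1), of y x] assms(2,3) by (auto simp: incident_def)

lemma incident_trans:
  assumes "polyhedron P" "incident P x y" "incident P y z" "rk P x < rk P y" "rk P y < rk P z"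
  shows "incident P x z"
proof -
  have "trans (leq P)"
    using polyhedronD(1)[OF assms(1)] by (rule partial_order_onD)
  moreover have "(x, y) \<in> leq P" "(y, z) \<in> leq P"
    by (rule incident_leqD[OF assms(1,2,4)], rule incident_leqD[OF assms(1,3,5)])
  ultimately have "(x, z) \<in> leq P"
    by (rule transD)
  then show ?thesis
    using assms(2-5) by (auto simp: incident_def)
qed

lemma differ_exactly_at_triple:
  "differ_exactly_at i (v, e, f) (v', e', f') \<longleftrightarrow>
     (v \<noteq> v' \<longleftrightarrow> i = 0) \<and> (e \<noteq> e' \<longleftrightarrow> i = 1) \<and> (f \<noteq> f' \<longleftrightarrow> i = 2)"
  by (auto simp: differ_exactly_at_def flag_elem_def)

lemma ex1_adj_flag:
  assumes P: "polyhedron P" and \<Phi>: "\<Phi> \<in> flags P" and i: "i \<in> {0, 1, 2}"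
  shows "\<exists>!\<Psi>. \<Psi> \<in> flags P \<and> differ_exactly_at i \<Phi> \<Psi>"
proof -
  obtain v e f where [simp]: "\<Phi> = (v, e, f)" by (cases \<Phi>)
  have vef: "v \<in> vertices P" "e \<in> edges P" "f \<in> faces P"
    "incident P v e" "incident P e f" "incident P v f"
    using \<Phi> by (auto simp: flags_def)
  have tr: "incident P a c" if "a \<in> vertices P" "b \<in> edges P" "c \<in> faces P"
    "incident P a b" "incident P b c" for a b c
    using incident_trans[OF P, of a b c] that by (auto simp: of_rank_def)
  consider "i = 0" | "i = 1" | "i = 2" using i by auto
  then show ?thesis
  proof cases
    case 1
    have "card {w \<in> vertices P. incident P w e} = 2"
      using P vef(2) by (rule polyhedronD(3))
    then obtain w where w: "w \<in> vertices P" "incident P w e" "v \<noteq> w"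
      and uniq: "\<And>w'. w' \<in> vertices P \<Longrightarrow> incident P w' e \<Longrightarrow> v \<noteq> w' \<Longrightarrow> w' = w"
      by (rule card_2_other[of _ v]) (use vef in blast)+
    show ?thesis
    proof (rule ex1I[of _ "(w, e, f)"])
      show "(w, e, f) \<in> flags P \<and> differ_exactly_at i \<Phi> (w, e, f)"
        using 1 w vef tr[OF w(1) vef(2,3) w(2) vef(5)] by (simp add: flags_def differ_exactly_at_triple)
    next
      fix \<Psi> assume "\<Psi> \<in> flags P \<and> differ_exactly_at i \<Phi> \<Psi>"
      then show "\<Psi> = (w, e, f)"
        using 1 uniq by (cases \<Psi>) (simp add: flags_def differ_exactly_at_triple)
    qed
  next
    case 2
    have "card {d \<in> edges P. incident P v d \<and> incident P d f} = 2"
      using P vef(1,3,6) by (rule polyhedronD(5))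
    then obtain d where d: "d \<in> edges P" "incident P v d" "incident P d f" "e \<noteq> d"
      and uniq: "\<And>d'. d' \<in> edges P \<Longrightarrow> incident P v d' \<Longrightarrow> incident P d' f \<Longrightarrow> e \<noteq> d' \<Longrightarrow> d' = d"
      by (rule card_2_other[of _ e]) (use vef in blast)+
    show ?thesis
    proof (rule ex1I[of _ "(v, d, f)"])
      show "(v, d, f) \<in> flags P \<and> differ_exactly_at i \<Phi> (v, d, f)"
        using 2 d vef by (simp add: flags_def differ_exactly_at_triple)
    next
      fix \<Psi> assume "\<Psi> \<in> flags P \<and> differ_exactly_at i \<Phi> \<Psi>"
      then show "\<Psi> = (v, d, f)"
        using 2 uniq by (cases \<Psi>) (simp add: flags_def differ_exactly_at_triple)
    qed
  next
    case 3
    have "card {g \<in> faces P. incident P e g} = 2"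
      using P vef(2) by (rule polyhedronD(4))
    then obtain g where g: "g \<in> faces P" "incident P e g" "f \<noteq> g"
      and uniq: "\<And>g'. g' \<in> faces P \<Longrightarrow> incident P e g' \<Longrightarrow> f \<noteq> g' \<Longrightarrow> g' = g"
      by (rule card_2_other[of _ f]) (use vef in blast)+
    show ?thesis
    proof (rule ex1I[of _ "(v, e, g)"])
      show "(v, e, g) \<in> flags P \<and> differ_exactly_at i \<Phi> (v, e, g)"
        using 3 g vef tr[OF vef(1,2) g(1) vef(4) g(2)] by (simp add: flags_def differ_exactly_at_triple)
    next
      fix \<Psi> assume "\<Psi> \<in> flags P \<and> differ_exactly_at i \<Phi> \<Psi>"
      then show "\<Psi> = (v, e, g)"
        using 3 uniq by (cases \<Psi>) (simp add: flags_def differ_exactly_at_triple)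
    qed
  qed
qed

text \<open>Automorphisms preserve ranks, hence map flags to flags; in particular dualities
  are excluded.\<close>

definition automorphism :: "'a ranked_poset \<Rightarrow> ('a \<Rightarrow> 'a) \<Rightarrow> bool" where
  "automorphism P g \<longleftrightarrow>
     bij_betw g (elems P) (elems P) \<and>
     (\<forall>x\<in>elems P. rk P (g x) = rk P x) \<and>
     (\<forall>x\<in>elems P. \<forall>y\<in>elems P. incident P (g x) (g y) \<longleftrightarrow> incident P x y)"

definition map_flag :: "('a \<Rightarrow> 'a) \<Rightarrow> 'a flag \<Rightarrow> 'a flag" where
  "map_flag g \<Phi> = (case \<Phi> of (v, e, f) \<Rightarrow> (g v, g e, g f))"

definition aut_transitive_on :: "'a ranked_poset \<Rightarrow> 'a flag set \<Rightarrow> bool" where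
  "aut_transitive_on P C \<longleftrightarrow>
     (\<forall>\<Phi>\<in>C. \<forall>\<Psi>\<in>C. \<exists>g. automorphism P g \<and> map_flag g \<Phi> = \<Psi>)"

definition chiral :: "'a ranked_poset \<Rightarrow> bool" where
  "chiral P \<longleftrightarrow>
     (\<exists>A B. A \<noteq> {} \<and> B \<noteq> {} \<and> A \<union> B = flags P \<and> A \<inter> B = {} \<and>
        (\<forall>\<Phi>\<in>flags P. \<forall>i\<in>{0, 1, 2}. \<Phi> \<in> A \<longleftrightarrow> adj_flag P i \<Phi> \<in> B) \<and>
        aut_transitive_on P A \<and> aut_transitive_on P B) \<and>
     \<not> aut_transitive_on P (flags P)"

text \<open>Finiteness is explicit because \<open>card\<close> is \<open>0\<close> on infinite sets.\<close>

definition has_type :: "'a ranked_poset \<Rightarrow> nat \<Rightarrow> nat \<Rightarrow> bool" where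
  "has_type P p q \<longleftrightarrow>
     (\<forall>f\<in>faces P. finite {e \<in> edges P. incident P e f} \<and> card {e \<in> edges P. incident P e f} = p) \<and>
     (\<forall>v\<in>vertices P. finite {e \<in> edges P. incident P v e} \<and> card {e \<in> edges P. incident P v e} = q)"

definition tight_of_type :: "'a ranked_poset \<Rightarrow> nat \<Rightarrow> nat \<Rightarrow> bool" where
  "tight_of_type P p q \<longleftrightarrow> has_type P p q \<and> finite (flags P) \<and> card (flags P) = 2 * p * q"

end

theory Submission
  imports Defs "HOL-Algebra.Group"
begin

text \<open>
  A finite group of order \<open>p * q\<close>, with elements \<open>a\<close>, \<open>b\<close> of orders \<open>p\<close>, \<open>q\<close> such that \<open>(a b)\<^sup>2 = 1\<close>
  and \<open>\<langle>a\<rangle> \<inter> \<langle>b\<rangle> = 1\<close>, acts on the polyhedron whose vertices, edges and faces are the left cosets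
  of \<open>\<langle>b\<rangle>\<close>, \<open>\<langle>a b\<rangle>\<close> and \<open>\<langle>a\<rangle>\<close>. Since \<open>\<langle>b\<rangle>\<langle>a\<rangle>\<close> is the whole group, every vertex is incident to every
  face and the polyhedron is tight. It is chiral unless some endomorphism sends \<open>a\<close> to \<open>a\<^sup>-\<^sup>1\<close> and
  \<open>b\<close> to \<open>a\<^sup>2 b\<close>.

  Such a group lives on \<open>\<int>/M \<times> \<int>/P \<times> \<int>/Q\<close>, where \<open>m | M | Q\<close>, \<open>m\<^sup>2 | Q\<close>, \<open>P\<close> is even and prime to \<open>M\<close>,
  and \<open>P = 2\<close> or \<open>Q\<close> is even: with \<open>t = Q / m\<close>, multiplication is
  \<open>(u, x, y) (u', x', y') = (u + u', x + (-1)\<^sup>y x', y + (-1)\<^sup>x (1 + u t) y')\<close>, and \<open>a = (1, 1, 0)\<close>,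
  \<open>b = (-1, 0, 1)\<close> have orders \<open>M P\<close> and \<open>Q\<close>. A reflection would have to invert \<open>(1, 0, 0)\<close>, a power of
  \<open>a\<close>, and fix the commutator \<open>(0, 0, t)\<close> of \<open>(1, 0, 0)\<close> with \<open>b\<close>; comparing both sides of the
  commutator relation gives \<open>2 t = 0\<close> modulo \<open>m t\<close>, which is impossible for odd \<open>m\<close>.

  If \<open>s\<close> is odd take \<open>M = r m\<close>, \<open>P = 2\<close>. If \<open>s\<close> is even let \<open>M\<close> be the \<open>m\<close>-part of \<open>r m\<close>
  when it divides \<open>s m\<^sup>2\<close>; otherwise the \<open>m\<close>-part of \<open>s m\<^sup>2\<close> divides \<open>r m\<close>, and the dual polyhedron
  is obtained in the same way.
\<close>

section \<open>Groups of tight chiral polyhedra\<close>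

lemma incident_sym: "incident P x y \<Longrightarrow> incident P y x"
  by (auto simp: incident_def)

lemma incidence_connectedI:
  assumes "x0 \<in> S" "\<And>x. x \<in> S \<Longrightarrow> (x0, x) \<in> {(a, b). a \<in> S \<and> b \<in> S \<and> incident P a b}\<^sup>*"
  shows "incidence_connected P S"
proof -
  let ?R = "{(a, b). a \<in> S \<and> b \<in> S \<and> incident P a b}"
  have "sym (?R\<^sup>*)"
    by (intro sym_rtrancl symI) (auto intro: incident_sym)
  then show ?thesis
    unfolding incidence_connected_def using assms by (meson empty_iff rtrancl_trans symD)
qed

text \<open>\<open>pow_eq\<close> combines the trivial intersection of the two cyclic subgroups with
  the lower bounds for both orders, which are the cases where one exponent is 0. The images in
  \<open>no_reflection\<close> are those that a symmetry of the polyhedron would induce if it fixed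
  the base edge and the base face and moved the base vertex to the other end of the edge.\<close>

locale tight_chiral_group = group G for G :: "('a, 'b) monoid_scheme" (structure) +
  fixes a b :: 'a and p q :: nat
  assumes a_closed [simp]: "a \<in> carrier G"
    and b_closed [simp]: "b \<in> carrier G"
    and p_gt_1: "p > 1"
    and q_gt_1: "q > 1"
    and finite_carrier: "finite (carrier G)"
    and card_carrier: "card (carrier G) = p * q"
    and a_pow: "a [^] p = \<one>"
    and b_pow: "b [^] q = \<one>"
    and pow_eq: "\<And>i j :: nat. a [^] i = b [^] j \<Longrightarrow> p dvd i \<and> q dvd j"
    and ab_involution: "(a \<otimes> b) \<otimes> (a \<otimes> b) = \<one>"
    and no_reflection: "\<And>\<rho>. \<rho> \<in> hom G G \<Longrightarrow> \<rho> a = inv a \<Longrightarrow> \<rho> b = a \<otimes> (a \<otimes> b) \<Longrightarrow> False"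
begin

lemma inv_cancel_left:
  assumes "x \<in> carrier G" "y \<in> carrier G"
  shows "inv x \<otimes> (x \<otimes> y) = y" "x \<otimes> (inv x \<otimes> y) = y"
  using assms by (simp_all add: m_assoc[symmetric])

lemma cancel_left:
  assumes "x \<in> carrier G" "y \<in> carrier G" "z \<in> carrier G"
  shows "x \<otimes> y = x \<otimes> z \<longleftrightarrow> y = z"
  using assms by simp

lemma pow_eq_oneD:
  shows "a [^] (i :: nat) = \<one> \<Longrightarrow> p dvd i" "b [^] (i :: nat) = \<one> \<Longrightarrow> q dvd i"
  using pow_eq[of i 0] pow_eq[of 0 i] by simp_all

lemma pow_inj:
  fixes i j :: nat
  assumes "x \<in> carrier G" "\<And>k :: nat. x [^] k = \<one> \<Longrightarrow> n dvd k"
    and "x [^] i = x [^] j" "i < n" "j < n"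
  shows "i = j"
  using assms(3-5)
proof (induction i j rule: linorder_wlog)
  case (le i j)
  have "x [^] i \<otimes> x [^] (j - i) = x [^] j"
    using le(1) assms(1) by (simp add: nat_pow_mult)
  then have "x [^] (j - i) = \<one>"
    using le(2) assms(1) by simp
  then have "n dvd j - i"
    by (rule assms(2))
  moreover have "j - i < n"
    using le by simp
  ultimately have "j - i = 0"
    using nat_dvd_not_less by auto
  then show ?case
    using le(1) by simp
qed simp

lemma a_pow_eq_one:
  assumes "p dvd i" shows "a [^] (i :: nat) = \<one>"
  using assms by (auto simp: dvd_def nat_pow_pow[symmetric] a_pow)

lemma a_ne_one: "a \<noteq> \<one>" and b_ne_one: "b \<noteq> \<one>"
  using pow_eq_oneD[of 1] p_gt_1 q_gt_1 by auto

text \<open>The half-turn about the base edge: it generates the stabiliser of the edge and exchanges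
  its two ends.\<close>

definition c where "c = a \<otimes> b"

lemma c_closed [simp]: "c \<in> carrier G"
  by (simp add: c_def)

lemma c_c [simp]: "c \<otimes> c = \<one>"
  using ab_involution by (simp add: c_def)

lemma c_cancel_left: "x \<in> carrier G \<Longrightarrow> c \<otimes> (c \<otimes> x) = x"
  by (simp add: m_assoc[symmetric])

lemma b_c: "b \<otimes> c = inv a"
proof -
  have "a \<otimes> (b \<otimes> c) = \<one>"
    using c_c by (simp add: c_def m_assoc)
  then show ?thesis
    by (metis a_closed b_closed c_closed inv_equality inv_inv m_closed inv_closed)
qed

lemma c_eq: "c = inv b \<otimes> inv a"
  using b_c by (metis b_closed c_closed inv_cancel_left(1))

lemma a_b_c: "a \<otimes> (a \<otimes> b) = a \<otimes> c"
  by (simp add: c_def)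

text \<open>Reversing the order of the polyhedron exchanges vertices and faces, and the two
  rotations become \<open>inv b\<close> and \<open>inv a\<close>, whose product is again
  \<open>c\<close>.\<close>

lemma dual: "tight_chiral_group G (inv b) (inv a) q p"
proof unfold_locales
  fix i j :: nat assume "inv b [^] i = inv a [^] j"
  then have "inv (b [^] i) = inv (a [^] j)"
    by (simp add: nat_pow_inv)
  then have "a [^] j = b [^] i"
    by (metis inv_inv nat_pow_closed a_closed b_closed)
  then show "q dvd i \<and> p dvd j"
    using pow_eq by blast
next
  have "inv b \<otimes> inv a = c" by (simp add: c_eq)
  then show "inv b \<otimes> inv a \<otimes> (inv b \<otimes> inv a) = \<one>" by simp
next
  fix \<rho> assume hom: "\<rho> \<in> hom G G" and rb: "\<rho> (inv b) = inv (inv b)"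
    and ra: "\<rho> (inv a) = inv b \<otimes> (inv b \<otimes> inv a)"
  interpret h: group_hom G G \<rho>
    using hom by unfold_locales
  have rb': "\<rho> b = inv b"
    using rb by (metis b_closed h.hom_inv inv_inv h.hom_closed)
  have ra': "\<rho> a = a \<otimes> (b \<otimes> b)"
    using ra h.hom_inv[of a] 
    by (metis a_closed b_closed h.hom_closed inv_closed inv_inv inv_mult_group m_closed m_assoc)
  \<comment> \<open>Followed by conjugation with the involution \<open>c\<close>, the dual
    reflection becomes one of the original kind: it sends \<open>a\<close> to \<open>inv a\<close>
    and \<open>b\<close> to \<open>a \<otimes> (a \<otimes> b)\<close>.\<close>
  have "(\<lambda>x. c \<otimes> (\<rho> x \<otimes> c)) \<in> hom G G"
  proof (rule homI)
    fix x y assume "x \<in> carrier G" "y \<in> carrier G"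
    then show "c \<otimes> (\<rho> (x \<otimes> y) \<otimes> c) = c \<otimes> (\<rho> x \<otimes> c) \<otimes> (c \<otimes> (\<rho> y \<otimes> c))"
      by (simp add: m_assoc c_cancel_left)
  qed simp
  moreover have "c \<otimes> (\<rho> a \<otimes> c) = inv a"
  proof -
    have "\<rho> a = c \<otimes> b" by (simp add: ra' c_def m_assoc)
    then have "c \<otimes> (\<rho> a \<otimes> c) = (c \<otimes> c) \<otimes> (b \<otimes> c)"
      by (simp add: m_assoc c_cancel_left)
    then show ?thesis by (simp add: b_c)
  qed
  moreover have "c \<otimes> (\<rho> b \<otimes> c) = a \<otimes> (a \<otimes> b)"
    unfolding rb' a_b_c by (simp add: c_def m_assoc inv_cancel_left)
  ultimately show False
    using no_reflection by blast
qed (use finite_carrier card_carrier p_gt_1 q_gt_1 a_pow b_pow in \<open>simp_all add: nat_pow_inv mult.commute\<close>)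

end

section \<open>The coset polyhedron\<close>

text \<open>The labels \<open>V g\<close>, \<open>E g\<close>, \<open>F g\<close> encode the cosets of \<open>g\<close> as natural numbers; the residue
  modulo 3 is the rank.\<close>

locale labelled_tight_chiral_group = tight_chiral_group +
  fixes V E F :: "'a \<Rightarrow> nat"
  assumes V_mod: "V g mod 3 = 0" and E_mod: "E g mod 3 = 1" and F_mod: "F g mod 3 = 2"
    and V_eq: "g \<in> carrier G \<Longrightarrow> h \<in> carrier G \<Longrightarrow> V g = V h \<longleftrightarrow> (\<exists>j :: nat. h = g \<otimes> b [^] j)"
    and E_eq: "g \<in> carrier G \<Longrightarrow> h \<in> carrier G \<Longrightarrow> E g = E h \<longleftrightarrow> h = g \<or> h = g \<otimes> c"
    and F_eq: "g \<in> carrier G \<Longrightarrow> h \<in> carrier G \<Longrightarrow> F g = F h \<longleftrightarrow> (\<exists>i :: nat. h = g \<otimes> a [^] i)"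
begin

section \<open>Equality of cosets and factorisation of the group\<close>

lemma label_ne [simp]:
  "V g \<noteq> E h" "V g \<noteq> F h" "E g \<noteq> V h" "E g \<noteq> F h" "F g \<noteq> V h" "F g \<noteq> E h"
  using V_mod[of g] V_mod[of h] E_mod[of g] E_mod[of h] F_mod[of g] F_mod[of h] by auto

lemma V_b_pow: "g \<in> carrier G \<Longrightarrow> V (g \<otimes> b [^] (j :: nat)) = V g"
  using V_eq[of g "g \<otimes> b [^] j"] by auto

lemma F_a_pow: "g \<in> carrier G \<Longrightarrow> F (g \<otimes> a [^] (i :: nat)) = F g"
  using F_eq[of g "g \<otimes> a [^] i"] by auto

lemma V_b [simp]: "g \<in> carrier G \<Longrightarrow> V (g \<otimes> b) = V g"
  using V_b_pow[of g 1] by simp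

lemma F_a [simp]: "g \<in> carrier G \<Longrightarrow> F (g \<otimes> a) = F g"
  using F_a_pow[of g 1] by simp

lemma E_c [simp]: "g \<in> carrier G \<Longrightarrow> E (g \<otimes> c) = E g"
  using E_eq[of g "g \<otimes> c"] by auto

lemma V_inv_b [simp]: "g \<in> carrier G \<Longrightarrow> V (g \<otimes> inv b) = V g"
  using V_b[of "g \<otimes> inv b"] by (simp add: m_assoc)

lemma F_inv_a [simp]: "g \<in> carrier G \<Longrightarrow> F (g \<otimes> inv a) = F g"
  using F_a[of "g \<otimes> inv a"] by (simp add: m_assoc)

lemma V_c: "g \<in> carrier G \<Longrightarrow> V (g \<otimes> c) = V (g \<otimes> a)"
  using V_b[of "g \<otimes> a"] by (simp add: m_assoc c_def)

lemma F_c: "g \<in> carrier G \<Longrightarrow> F (g \<otimes> c) = F (g \<otimes> inv b)"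
  using F_inv_a[of "g \<otimes> inv b"] by (simp add: m_assoc c_eq)

text \<open>If \<open>g\<close> and \<open>h\<close> differ both by a power of \<open>b\<close> and
  by a power of \<open>a\<close>, the two powers are equal and hence trivial. Thus a vertex and a
  face share at most one group element, their pivot.\<close>

lemma pivot_unique:
  assumes "g \<in> carrier G" "h \<in> carrier G" "V g = V h" "F g = F h"
  shows "g = h"
proof -
  obtain i j :: nat where ij: "h = g \<otimes> b [^] j" "h = g \<otimes> a [^] i"
    using assms V_eq F_eq by metis
  then have "a [^] i = b [^] j"
    using assms(1) by (metis cancel_left a_closed b_closed nat_pow_closed)
  then have "a [^] i = \<one>"
    using pow_eq a_pow_eq_one by blast
  then show ?thesis
    using ij assms by simp
qed

text \<open>The other end of the edge is the vertex of \<open>g \<otimes> a\<close>, which shares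
  the face of \<open>g\<close>; a common vertex would make \<open>a\<close> trivial by
  \<open>pivot_unique\<close>.\<close>

lemma V_c_ne [simp]: "g \<in> carrier G \<Longrightarrow> V (g \<otimes> c) \<noteq> V g"
  using pivot_unique[of "g \<otimes> a" g] a_ne_one l_cancel_one[of g a] by (auto simp: V_c)

lemma F_c_ne [simp]: "g \<in> carrier G \<Longrightarrow> F (g \<otimes> c) \<noteq> F g"
  using pivot_unique[of "g \<otimes> inv b" g] b_ne_one l_cancel_one[of g "inv b"] by (auto simp: F_c)

lemma E_a_ne [simp]: "g \<in> carrier G \<Longrightarrow> E (g \<otimes> a) \<noteq> E g"
  using E_eq[of g "g \<otimes> a"] a_ne_one b_ne_one l_cancel_one[of g a] l_cancel_one[of a b]
  by (auto simp: c_def)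

lemma E_b_ne [simp]: "g \<in> carrier G \<Longrightarrow> E (g \<otimes> b) \<noteq> E g"
  using E_eq[of g "g \<otimes> b"] a_ne_one b_ne_one l_cancel_one[of g b] r_cancel_one[of b a]
  by (auto simp: c_def)

text \<open>All powers of \<open>b\<close> lie in the base vertex, and
  \<open>b [^] j \<otimes> a [^] i\<close> lies in the face of \<open>b [^] j\<close>, so the
  product determines its left factor by \<open>pivot_unique\<close>.\<close>

lemma b_pow_a_pow_inj: "inj_on (\<lambda>(j :: nat, i :: nat). b [^] j \<otimes> a [^] i) ({..<q} \<times> {..<p})"
proof -
  show ?thesis
  proof (rule inj_onI, clarify)
    fix j i j' i' assume *: "j < q" "i < p" "j' < q" "i' < p"
      "b [^] j \<otimes> a [^] i = b [^] j' \<otimes> a [^] i'"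
    have "F (b [^] j) = F (b [^] j')"
      using F_a_pow[of "b [^] j" i] F_a_pow[of "b [^] j'" i'] *(5) by simp
    moreover have "V (b [^] j) = V (b [^] j')"
      using V_b_pow[of \<one> j] V_b_pow[of \<one> j'] by simp
    ultimately have "b [^] j = b [^] j'"
      by (intro pivot_unique) simp_all
    with * show "j = j' \<and> i = i'"
      using pow_inj[of a p i i'] pow_inj[of b q j j'] pow_eq_oneD by simp
  qed
qed

text \<open>By counting: there are \<open>p * q\<close> distinct products, as many as group
  elements.\<close>

lemma b_pow_a_pow:
  assumes "x \<in> carrier G"
  obtains i j :: nat where "i < p" "j < q" "x = b [^] j \<otimes> a [^] i"
proof -
  let ?f = "\<lambda>(j :: nat, i :: nat). b [^] j \<otimes> a [^] i"
  have "card (?f ` ({..<q} \<times> {..<p})) = card (carrier G)"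
    using card_image[OF b_pow_a_pow_inj] card_carrier by (simp add: mult.commute)
  then have "?f ` ({..<q} \<times> {..<p}) = carrier G"
    by (intro card_subset_eq finite_carrier) auto
  then have "x \<in> ?f ` ({..<q} \<times> {..<p})"
    using assms by simp
  then show thesis
    using that by auto
qed

text \<open>Writing \<open>inv g \<otimes> h\<close> as a power of \<open>b\<close> times a power of
  \<open>a\<close> splits the way from \<open>g\<close> to \<open>h\<close> into a step inside the
  vertex and a step inside the face.\<close>

lemma pivot_exists:
  assumes "g \<in> carrier G" "h \<in> carrier G"
  obtains k where "k \<in> carrier G" "V k = V g" "F k = F h"
proof -
  obtain i j :: nat where "inv g \<otimes> h = b [^] j \<otimes> a [^] i"
    using assms b_pow_a_pow[of "inv g \<otimes> h"] by (metis inv_closed m_closed)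
  then have "h = g \<otimes> b [^] j \<otimes> a [^] i"
    using assms by (metis a_closed b_closed inv_cancel_left(2) m_assoc nat_pow_closed)
  then have "F (g \<otimes> b [^] j) = F h"
    using assms F_a_pow[of "g \<otimes> b [^] j" i] by simp
  with that[of "g \<otimes> b [^] j"] show thesis
    using assms V_b_pow by simp
qed

section \<open>The poset of cosets and its incidences\<close>

definition poset :: "nat ranked_poset" where
  "poset = \<lparr>elems = V ` carrier G \<union> E ` carrier G \<union> F ` carrier G,
    leq = Id_on (V ` carrier G \<union> E ` carrier G \<union> F ` carrier G) \<union>
      (\<Union>g \<in> carrier G. {(V g, E g), (E g, F g), (V g, F g)}),
    rk = (\<lambda>n. n mod 3)\<rparr>"

lemma elems_poset: "elems poset = V ` carrier G \<union> E ` carrier G \<union> F ` carrier G"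
  by (simp add: poset_def)

lemma rk_poset [simp]: "rk poset n = n mod 3"
  by (simp add: poset_def)

lemma leq_poset: "(x, y) \<in> leq poset \<longleftrightarrow> x \<in> elems poset \<and> x = y \<or>
    (\<exists>g \<in> carrier G. (x, y) \<in> {(V g, E g), (E g, F g), (V g, F g)})"
  by (auto simp: poset_def Id_on_iff)

lemma of_rank_poset:
  "vertices poset = V ` carrier G" "edges poset = E ` carrier G" "of_rank poset (Suc 0) = E ` carrier G"
  "faces poset = F ` carrier G"
proof -
  have "rk poset (V g) = 0" "rk poset (E g) = 1" "rk poset (F g) = 2" for g
    using V_mod E_mod F_mod by simp_all
  then show "vertices poset = V ` carrier G" "edges poset = E ` carrier G"
    "of_rank poset (Suc 0) = E ` carrier G" "faces poset = F ` carrier G"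
    by (auto simp: of_rank_def elems_poset simp del: rk_poset)
qed

lemma incident_poset:
  assumes "g \<in> carrier G"
  shows "incident poset (V g) (E g)" "incident poset (E g) (F g)" "incident poset (V g) (F g)"
  using assms by (auto simp: incident_def leq_poset elems_poset)

text \<open>Incident elements share a group element, and the coset of an edge contains only
  \<open>h\<close> and \<open>h \<otimes> c\<close>.\<close>

lemma incident_VE:
  assumes "g \<in> carrier G" "h \<in> carrier G"
  shows "incident poset (V g) (E h) \<longleftrightarrow> V g = V h \<or> V g = V (h \<otimes> c)"
proof
  assume "incident poset (V g) (E h)"
  then obtain k where "k \<in> carrier G" "V g = V k" "E h = E k"
    by (auto simp: incident_def leq_poset)
  then show "V g = V h \<or> V g = V (h \<otimes> c)"
    using E_eq[of h k] assms by auto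
next
  assume "V g = V h \<or> V g = V (h \<otimes> c)"
  then show "incident poset (V g) (E h)"
    using assms incident_poset[of h] incident_poset[of "h \<otimes> c"] by auto
qed

lemma incident_EF:
  assumes "g \<in> carrier G" "h \<in> carrier G"
  shows "incident poset (E h) (F g) \<longleftrightarrow> F g = F h \<or> F g = F (h \<otimes> c)"
proof
  assume "incident poset (E h) (F g)"
  then obtain k where "k \<in> carrier G" "F g = F k" "E h = E k"
    by (auto simp: incident_def leq_poset)
  then show "F g = F h \<or> F g = F (h \<otimes> c)"
    using E_eq[of h k] assms by auto
next
  assume "F g = F h \<or> F g = F (h \<otimes> c)"
  then show "incident poset (E h) (F g)"
    using assms incident_poset[of h] incident_poset[of "h \<otimes> c"] by auto
qed

text \<open>The pivot of any vertex and any face exists because the group is exhausted by the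
  products \<open>b [^] j \<otimes> a [^] i\<close>.\<close>

lemma incident_VF:
  assumes "g \<in> carrier G" "h \<in> carrier G"
  shows "incident poset (V g) (F h)"
proof -
  obtain k where "k \<in> carrier G" "V k = V g" "F k = F h"
    using assms by (rule pivot_exists)
  then show ?thesis
    using incident_poset(3)[of k] by simp
qed

lemma vertices_on_edge:
  assumes "g \<in> carrier G"
  shows "{v \<in> vertices poset. incident poset v (E g)} = {V g, V (g \<otimes> c)}"
  using assms by (auto simp: of_rank_poset incident_VE)

lemma faces_on_edge:
  assumes "g \<in> carrier G"
  shows "{f \<in> faces poset. incident poset (E g) f} = {F g, F (g \<otimes> c)}"
  using assms by (auto simp: of_rank_poset incident_EF)

lemma edges_at_vertex:
  assumes "g \<in> carrier G"
  shows "{e \<in> edges poset. incident poset (V g) e} = {E (g \<otimes> b [^] j) |j :: nat. True}"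
proof (intro equalityI subsetI)
  fix e assume "e \<in> {e \<in> edges poset. incident poset (V g) e}"
  then obtain h where h: "h \<in> carrier G" "e = E h" "V g = V h \<or> V g = V (h \<otimes> c)"
    using assms by (auto simp: of_rank_poset incident_VE)
  \<comment> \<open>If the incidence holds through the other member \<open>h \<otimes> c\<close> of
    the edge, that one is taken as the representative.\<close>
  then obtain k where "k \<in> carrier G" "e = E k" "V g = V k"
    by (metis E_c c_closed m_closed)
  then show "e \<in> {E (g \<otimes> b [^] j) |j :: nat. True}"
    using V_eq assms by auto
qed (use assms in \<open>auto simp: of_rank_poset incident_VE V_b_pow\<close>)

lemma edges_at_face:
  assumes "g \<in> carrier G"
  shows "{e \<in> edges poset. incident poset e (F g)} = {E (g \<otimes> a [^] j) |j :: nat. True}"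
proof (intro equalityI subsetI)
  fix e assume "e \<in> {e \<in> edges poset. incident poset e (F g)}"
  then obtain h where h: "h \<in> carrier G" "e = E h" "F g = F h \<or> F g = F (h \<otimes> c)"
    using assms by (auto simp: of_rank_poset incident_EF)
  then obtain k where "k \<in> carrier G" "e = E k" "F g = F k"
    by (metis E_c c_closed m_closed)
  then show "e \<in> {E (g \<otimes> a [^] j) |j :: nat. True}"
    using F_eq assms by auto
qed (use assms in \<open>auto simp: of_rank_poset incident_EF F_a_pow\<close>)

lemma F_b_c: "k \<in> carrier G \<Longrightarrow> F (k \<otimes> b \<otimes> c) = F k"
  by (simp add: m_assoc b_c)

text \<open>An edge is incident to the vertex and to the face through \<open>h\<close> or through
  \<open>h \<otimes> c\<close>. If the same member serves both, it is the pivot \<open>k\<close>; if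
  different members do, the edge is the one of \<open>k \<otimes> b\<close>.\<close>

lemma edges_at_pivot:
  assumes "k \<in> carrier G"
  shows "{e \<in> edges poset. incident poset (V k) e \<and> incident poset e (F k)} = {E k, E (k \<otimes> b)}"
proof (intro equalityI subsetI)
  fix e assume "e \<in> {e \<in> edges poset. incident poset (V k) e \<and> incident poset e (F k)}"
  then obtain h where h: "h \<in> carrier G" "e = E h" "V k = V h \<or> V k = V (h \<otimes> c)"
    "F k = F h \<or> F k = F (h \<otimes> c)"
    using assms by (auto simp: of_rank_poset incident_VE incident_EF)
  then consider "V k = V h" "F k = F h" | "V k = V (h \<otimes> c)" "F k = F (h \<otimes> c)"
    | "V k = V h" "F k = F (h \<otimes> c)" | "V k = V (h \<otimes> c)" "F k = F h"
    by blast
  then show "e \<in> {E k, E (k \<otimes> b)}"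
  proof cases
    case 1
    then show ?thesis using h assms pivot_unique[of k h] by simp
  next
    case 2
    then show ?thesis using h assms pivot_unique[of k "h \<otimes> c"] by simp
  next
    case 3
    then have "k = h \<otimes> inv b"
      using h assms by (intro pivot_unique) (simp_all add: F_c)
    then show ?thesis using h by (simp add: m_assoc)
  next
    case 4
    then have "k = h \<otimes> a"
      using h assms by (intro pivot_unique) (simp_all add: V_c)
    then have "k \<otimes> b = h \<otimes> c" using h by (simp add: c_def m_assoc)
    then show ?thesis using h by simp
  qed
next
  fix e assume "e \<in> {E k, E (k \<otimes> b)}"
  then show "e \<in> {e \<in> edges poset. incident poset (V k) e \<and> incident poset e (F k)}"
    using assms by (auto simp: of_rank_poset incident_VE incident_EF F_b_c)
qed

section \<open>Connectedness and the polyhedron axioms\<close>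

lemma connected_poset: "incidence_connected poset (elems poset)"
proof (rule incidence_connectedI[of "V \<one>"])
  let ?R = "{(x, y). x \<in> elems poset \<and> y \<in> elems poset \<and> incident poset x y}"
  have F: "(V \<one>, F g) \<in> ?R" if "g \<in> carrier G" for g
    using that by (auto simp: elems_poset incident_VF)
  have V: "(F \<one>, V g) \<in> ?R" if "g \<in> carrier G" for g
    using that by (auto simp: elems_poset intro!: incident_sym[OF incident_VF])
  have E: "(F g, E g) \<in> ?R" if "g \<in> carrier G" for g
    using that by (auto simp: elems_poset incident_EF intro!: incident_sym[of _ "E g"])
  fix x assume "x \<in> elems poset"
  then obtain g where g: "g \<in> carrier G" "x = V g \<or> x = E g \<or> x = F g"
    by (auto simp: elems_poset)
  \<comment> \<open>Each vertex is adjacent to each face, so other vertices are reached through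
    \<open>F \<one>\<close>, and edges through their own face.\<close>
  have "(V \<one>, F \<one>) \<in> ?R\<^sup>*" "(V \<one>, F g) \<in> ?R\<^sup>*"
    using F g by blast+
  then have "(V \<one>, V g) \<in> ?R\<^sup>*" "(V \<one>, E g) \<in> ?R\<^sup>*" "(V \<one>, F g) \<in> ?R\<^sup>*"
    using V[OF g(1)] E[OF g(1)] by (blast intro: rtrancl.rtrancl_into_rtrancl)+
  then show "(V \<one>, x) \<in> ?R\<^sup>*"
    using g(2) by auto
qed (simp add: elems_poset)

text \<open>The edges and faces around a vertex alternate: the edge of
  \<open>g \<otimes> b [^] Suc j\<close> separates the faces of \<open>g \<otimes> b [^] j\<close>
  and \<open>g \<otimes> b [^] Suc j\<close>.\<close>

lemma connected_vertex_figure: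
  assumes g: "g \<in> carrier G"
  shows "incidence_connected poset (incidence_neighbours poset (V g))"
proof (rule incidence_connectedI[of "F g"])
  let ?S = "incidence_neighbours poset (V g)"
  let ?R = "{(x, y). x \<in> ?S \<and> y \<in> ?S \<and> incident poset x y}"
  have FS: "F h \<in> ?S" if "h \<in> carrier G" for h
    using that g by (simp add: incidence_neighbours_def incident_VF)
  have ES: "E (g \<otimes> b [^] j) \<in> ?S" for j :: nat
    using g by (simp add: incidence_neighbours_def incident_VE V_b_pow)
  have 1: "(F (g \<otimes> b [^] j), E (g \<otimes> b [^] j)) \<in> ?R" for j :: nat
    using g FS ES by (auto simp: incident_EF intro!: incident_sym[of _ "E _"])
  have 2: "(F (g \<otimes> b [^] j), E (g \<otimes> b [^] Suc j)) \<in> ?R" for j :: nat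
    using g FS ES[of "Suc j"] F_b_c[of "g \<otimes> b [^] j"]
    by (auto simp: incident_EF m_assoc intro!: incident_sym[of _ "E _"])
  have 3: "(E (g \<otimes> b [^] j), F (g \<otimes> b [^] j)) \<in> ?R" for j :: nat
    using 1[of j] by (auto intro: incident_sym)
  have F: "(F g, F (g \<otimes> b [^] j)) \<in> ?R\<^sup>*" for j :: nat
  proof (induction j)
    case (Suc j)
    then show ?case
      using 2[of j] 3[of "Suc j"] by (meson rtrancl.rtrancl_into_rtrancl)
  qed (use g in simp)
  have E: "(F g, E (g \<otimes> b [^] j)) \<in> ?R\<^sup>*" for j :: nat
    using F[of j] 1[of j] by (rule rtrancl.rtrancl_into_rtrancl)
  fix x assume x: "x \<in> ?S"
  then have "x \<in> elems poset"
    by (auto simp: incidence_neighbours_def incident_def)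
  then consider "x \<in> edges poset" | h where "h \<in> carrier G" "x = F h" | h where "h \<in> carrier G" "x = V h"
    by (auto simp: elems_poset of_rank_poset)
  then show "(F g, x) \<in> ?R\<^sup>*"
  proof cases
    case 1
    then have "x \<in> {e \<in> edges poset. incident poset (V g) e}"
      using x by (simp add: incidence_neighbours_def)
    then show ?thesis
      unfolding edges_at_vertex[OF g] using E by auto
  next
    case 2
    obtain k where k: "k \<in> carrier G" "V k = V g" "F k = F h"
      using g 2(1) by (rule pivot_exists)
    obtain j :: nat where "k = g \<otimes> b [^] j"
      using V_eq[OF g k(1)] k(2) by auto
    then show ?thesis
      using F[of j] k(3) 2(2) by simp
  next
    case 3
    then show ?thesis
      using x by (auto simp: incidence_neighbours_def incident_def leq_poset)
  qed
qed (use g in \<open>simp add: incidence_neighbours_def incident_VF\<close>)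

text \<open>Dually, the edge of \<open>g \<otimes> a [^] j\<close> joins the vertices of
  \<open>g \<otimes> a [^] j\<close> and \<open>g \<otimes> a [^] Suc j\<close>, and these edges run
  around the face.\<close>

lemma connected_face_figure:
  assumes g: "g \<in> carrier G"
  shows "incidence_connected poset (incidence_neighbours poset (F g))"
proof (rule incidence_connectedI[of "V g"])
  let ?S = "incidence_neighbours poset (F g)"
  let ?R = "{(x, y). x \<in> ?S \<and> y \<in> ?S \<and> incident poset x y}"
  have VS: "V h \<in> ?S" if "h \<in> carrier G" for h
    using that g by (simp add: incidence_neighbours_def incident_sym[OF incident_VF])
  have ES: "E (g \<otimes> a [^] j) \<in> ?S" for j :: nat
    using g by (auto simp: incidence_neighbours_def incident_EF F_a_pow intro!: incident_sym[of _ "E _"])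
  have 1: "(V (g \<otimes> a [^] j), E (g \<otimes> a [^] j)) \<in> ?R" for j :: nat
    using g VS ES by (auto simp: incident_VE)
  have 2: "(E (g \<otimes> a [^] j), V (g \<otimes> a [^] Suc j)) \<in> ?R" for j :: nat
    using g VS ES[of j] V_c[of "g \<otimes> a [^] j"]
    by (auto simp: incident_VE m_assoc intro!: incident_sym[of _ "V _"])
  have V: "(V g, V (g \<otimes> a [^] j)) \<in> ?R\<^sup>*" for j :: nat
  proof (induction j)
    case (Suc j)
    then show ?case
      using 1[of j] 2[of j] by (meson rtrancl.rtrancl_into_rtrancl)
  qed (use g in simp)
  have E: "(V g, E (g \<otimes> a [^] j)) \<in> ?R\<^sup>*" for j :: nat
    using V[of j] 1[of j] by (rule rtrancl.rtrancl_into_rtrancl)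
  fix x assume x: "x \<in> ?S"
  then have "x \<in> elems poset"
    by (auto simp: incidence_neighbours_def incident_def)
  then consider "x \<in> edges poset" | h where "h \<in> carrier G" "x = V h" | h where "h \<in> carrier G" "x = F h"
    by (auto simp: elems_poset of_rank_poset)
  then show "(V g, x) \<in> ?R\<^sup>*"
  proof cases
    case 1
    then have "x \<in> {e \<in> edges poset. incident poset e (F g)}"
      using x by (simp add: incidence_neighbours_def incident_sym)
    then show ?thesis
      unfolding edges_at_face[OF g] using E by auto
  next
    case 2
    obtain k where k: "k \<in> carrier G" "V k = V h" "F k = F g"
      using 2(1) g by (rule pivot_exists)
    obtain j :: nat where "k = g \<otimes> a [^] j"
      using F_eq[OF g k(1)] k(3) by auto
    then show ?thesis
      using V[of j] k(2) 2(2) by simp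
  next
    case 3
    then show ?thesis
      using x by (auto simp: incidence_neighbours_def incident_def leq_poset)
  qed
qed (use g in \<open>simp add: incidence_neighbours_def incident_sym[OF incident_VF]\<close>)

text \<open>Transitivity is immediate because every vertex lies below every face.\<close>

lemma partial_order_poset: "partial_order_on (elems poset) (leq poset)"
proof -
  have VF: "(V g, F h) \<in> leq poset" if "g \<in> carrier G" "h \<in> carrier G" for g h
    using incident_VF[OF that] by (auto simp: incident_def leq_poset)
  have "refl_on (elems poset) (leq poset)"
    by (auto simp: refl_on_def leq_poset elems_poset)
  moreover have "leq poset \<subseteq> elems poset \<times> elems poset"
    by (auto simp: leq_poset elems_poset)
  moreover have "antisym (leq poset)"
    by (auto simp: antisym_def leq_poset elems_poset)
  moreover have "trans (leq poset)"
  proof (rule transI)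
    fix x y z assume "(x, y) \<in> leq poset" "(y, z) \<in> leq poset"
    moreover from this have "x = y \<or> y = z \<or> (\<exists>g\<in>carrier G. \<exists>h\<in>carrier G. x = V g \<and> z = F h)"
      by (auto simp: leq_poset)
    ultimately show "(x, z) \<in> leq poset"
      using VF by auto
  qed
  ultimately show ?thesis
    by (auto simp: partial_order_on_def preorder_on_def)
qed

lemma polyhedron_poset: "polyhedron poset"
  unfolding polyhedron_def
proof (intro conjI ballI impI allI)
  fix x assume "x \<in> elems poset"
  then show "rk poset x \<in> {0, 1, 2}"
    by (auto simp: elems_poset V_mod E_mod F_mod)
next
  fix x y assume "(x, y) \<in> leq poset \<and> x \<noteq> y"
  then show "rk poset x < rk poset y"
    by (auto simp: leq_poset V_mod E_mod F_mod)
next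
  fix e assume "e \<in> edges poset"
  then obtain g where g: "g \<in> carrier G" "e = E g" by (auto simp: of_rank_poset)
  show "card {v \<in> vertices poset. incident poset v e} = 2"
    using V_c_ne[OF g(1), symmetric] g by (simp add: vertices_on_edge)
  show "card {f \<in> faces poset. incident poset e f} = 2"
    using F_c_ne[OF g(1), symmetric] g by (simp add: faces_on_edge)
next
  fix v f assume "v \<in> vertices poset" "f \<in> faces poset"
  then obtain k where k: "k \<in> carrier G" "v = V k" "f = F k"
    by (auto simp: of_rank_poset) (metis pivot_exists)
  then show "card {e \<in> edges poset. incident poset v e \<and> incident poset e f} = 2"
    using E_b_ne[OF k(1), symmetric] edges_at_pivot[OF k(1)] by simp
next
  fix x assume "x \<in> vertices poset \<union> faces poset"
  then show "incidence_connected poset (incidence_neighbours poset x)"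
    by (auto simp: of_rank_poset connected_vertex_figure connected_face_figure)
qed (rule partial_order_poset connected_poset)+

lemma has_type_poset: "has_type poset p q"
  unfolding has_type_def
proof (intro conjI ballI)
  fix f assume "f \<in> faces poset"
  then obtain g where g: "g \<in> carrier G" "f = F g" by (auto simp: of_rank_poset)
  have a_mod: "a [^] i = a [^] (i mod p)" for i :: nat
    using nat_pow_mult[of a "p * (i div p)" "i mod p"] by (simp add: nat_pow_pow[symmetric] a_pow)
  have "{E (g \<otimes> a [^] i) |i :: nat. True} = (\<lambda>i. E (g \<otimes> a [^] i)) ` {..<p}"
  proof (intro equalityI subsetI)
    fix e assume "e \<in> {E (g \<otimes> a [^] i) |i :: nat. True}"
    then obtain i :: nat where "e = E (g \<otimes> a [^] (i mod p))"
      using a_mod by auto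
    then show "e \<in> (\<lambda>i. E (g \<otimes> a [^] i)) ` {..<p}"
      using p_gt_1 by auto
  qed auto
  then have eq: "{e \<in> edges poset. incident poset e f} = (\<lambda>i. E (g \<otimes> a [^] i)) ` {..<p}"
    using edges_at_face[OF g(1)] g(2) by simp
  have "inj_on (\<lambda>i. E (g \<otimes> a [^] i)) {..<p}"
  proof (rule inj_onI)
    fix i j assume ij: "i \<in> {..<p}" "j \<in> {..<p}" "E (g \<otimes> a [^] i) = E (g \<otimes> a [^] j)"
    then have "g \<otimes> a [^] j = g \<otimes> a [^] i \<or> g \<otimes> a [^] j = g \<otimes> a [^] i \<otimes> c"
      using E_eq g by simp
    \<comment> \<open>The second alternative would put the same face on both sides of an
      edge.\<close>
    then have "g \<otimes> a [^] j = g \<otimes> a [^] i"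
      using F_c_ne[of "g \<otimes> a [^] i"] g by (metis F_a_pow a_closed m_closed nat_pow_closed)
    then show "i = j"
      using pow_inj[of a p i j] ij g pow_eq_oneD by simp
  qed
  then show "card {e \<in> edges poset. incident poset e f} = p"
    unfolding eq by (simp add: card_image)
  show "finite {e \<in> edges poset. incident poset e f}"
    unfolding eq by simp
next
  fix v assume "v \<in> vertices poset"
  then obtain g where g: "g \<in> carrier G" "v = V g" by (auto simp: of_rank_poset)
  have b_mod: "b [^] i = b [^] (i mod q)" for i :: nat
    using nat_pow_mult[of b "q * (i div q)" "i mod q"] by (simp add: nat_pow_pow[symmetric] b_pow)
  have "{E (g \<otimes> b [^] i) |i :: nat. True} = (\<lambda>i. E (g \<otimes> b [^] i)) ` {..<q}"
  proof (intro equalityI subsetI)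
    fix e assume "e \<in> {E (g \<otimes> b [^] i) |i :: nat. True}"
    then obtain i :: nat where "e = E (g \<otimes> b [^] (i mod q))"
      using b_mod by auto
    then show "e \<in> (\<lambda>i. E (g \<otimes> b [^] i)) ` {..<q}"
      using q_gt_1 by auto
  qed auto
  then have eq: "{e \<in> edges poset. incident poset v e} = (\<lambda>i. E (g \<otimes> b [^] i)) ` {..<q}"
    using edges_at_vertex[OF g(1)] g(2) by simp
  have "inj_on (\<lambda>i. E (g \<otimes> b [^] i)) {..<q}"
  proof (rule inj_onI)
    fix i j assume ij: "i \<in> {..<q}" "j \<in> {..<q}" "E (g \<otimes> b [^] i) = E (g \<otimes> b [^] j)"
    then have "g \<otimes> b [^] j = g \<otimes> b [^] i \<or> g \<otimes> b [^] j = g \<otimes> b [^] i \<otimes> c"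
      using E_eq g by simp
    then have "g \<otimes> b [^] j = g \<otimes> b [^] i"
      using V_c_ne[of "g \<otimes> b [^] i"] g by (metis V_b_pow b_closed m_closed nat_pow_closed)
    then show "i = j"
      using pow_inj[of b q i j] ij g pow_eq_oneD by simp
  qed
  then show "card {e \<in> edges poset. incident poset v e} = q"
    unfolding eq by (simp add: card_image)
  show "finite {e \<in> edges poset. incident poset v e}"
    unfolding eq by simp
qed

section \<open>The two classes of flags\<close>

definition even_flag :: "'a \<Rightarrow> nat flag" where
  "even_flag g = (V g, E g, F g)"

text \<open>The flag that differs from \<open>even_flag g\<close> exactly in the vertex.\<close>

definition odd_flag :: "'a \<Rightarrow> nat flag" where
  "odd_flag g = (V (g \<otimes> c), E g, F g)"

lemma c_cancel_right: "g \<in> carrier G \<Longrightarrow> g \<otimes> c \<otimes> c = g"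
  by (simp add: m_assoc)

text \<open>The four flags on the edge of \<open>g\<close> are the even and the odd flag of
  \<open>g\<close> and of \<open>g \<otimes> c\<close>.\<close>

lemma flags_poset: "flags poset = even_flag ` carrier G \<union> odd_flag ` carrier G"
proof (intro equalityI subsetI)
  fix \<Phi> assume "\<Phi> \<in> flags poset"
  then obtain v g f where g: "g \<in> carrier G" "\<Phi> = (v, E g, f)"
    "v \<in> {v \<in> vertices poset. incident poset v (E g)}" "f \<in> {f \<in> faces poset. incident poset (E g) f}"
    by (auto simp: flags_def of_rank_poset)
  then have "v = V g \<or> v = V (g \<otimes> c)" "f = F g \<or> f = F (g \<otimes> c)"
    by (simp_all only: vertices_on_edge faces_on_edge) auto
  then have "\<Phi> \<in> {even_flag g, odd_flag g, even_flag (g \<otimes> c), odd_flag (g \<otimes> c)}"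
    using g by (auto simp: even_flag_def odd_flag_def c_cancel_right)
  then show "\<Phi> \<in> even_flag ` carrier G \<union> odd_flag ` carrier G"
    using g by auto
next
  fix \<Phi> assume "\<Phi> \<in> even_flag ` carrier G \<union> odd_flag ` carrier G"
  then show "\<Phi> \<in> flags poset"
    by (auto simp: flags_def of_rank_poset even_flag_def odd_flag_def
        incident_VE incident_EF incident_VF)
qed

text \<open>Any two entries of an even flag determine its group element, so even flags that agree in
  two places are equal.\<close>

lemma even_flags_not_adjacent:
  assumes "g \<in> carrier G" "h \<in> carrier G" "i \<in> {0, 1, 2}"
  shows "\<not> differ_exactly_at i (even_flag g) (even_flag h)"
proof
  assume *: "differ_exactly_at i (even_flag g) (even_flag h)"
  have "g = h" if "V g = V h" "F g = F h"
    using assms(1,2) that by (rule pivot_unique)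
  moreover have "g = h" if "E g = E h" "V g = V h \<or> F g = F h"
    using that E_eq[OF assms(1,2)] V_c_ne[OF assms(1)] F_c_ne[OF assms(1)] by auto
  ultimately have "g = h"
    using * assms(3) by (auto simp: even_flag_def differ_exactly_at_triple)
  then show False
    using * assms(3) by (auto simp: even_flag_def differ_exactly_at_triple)
qed

lemma odd_flags_not_adjacent:
  assumes "g \<in> carrier G" "h \<in> carrier G" "i \<in> {0, 1, 2}"
  shows "\<not> differ_exactly_at i (odd_flag g) (odd_flag h)"
proof
  assume *: "differ_exactly_at i (odd_flag g) (odd_flag h)"
  \<comment> \<open>\<open>g \<otimes> c\<close> and \<open>g \<otimes> a\<close> lie in the same
    vertex, and \<open>g \<otimes> a\<close> keeps the face of \<open>g\<close>, so the pivots to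
    compare are \<open>g \<otimes> a\<close> and \<open>h \<otimes> a\<close>.\<close>
  have "g = h" if "V (g \<otimes> c) = V (h \<otimes> c)" "F g = F h"
    using that pivot_unique[of "g \<otimes> a" "h \<otimes> a"] assms by (simp add: V_c)
  moreover have "g = h" if "E g = E h" "V (g \<otimes> c) = V (h \<otimes> c) \<or> F g = F h"
    using that E_eq[OF assms(1,2)] V_c_ne[of h] F_c_ne[of g] assms c_cancel_right[of g] by metis
  ultimately have "g = h"
    using * assms(3) by (auto simp: odd_flag_def differ_exactly_at_triple)
  then show False
    using * assms(3) by (auto simp: odd_flag_def differ_exactly_at_triple)
qed

lemma even_flag_ne_odd_flag:
  assumes "g \<in> carrier G" "h \<in> carrier G"
  shows "even_flag g \<noteq> odd_flag h"
proof
  assume "even_flag g = odd_flag h"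
  then have *: "V g = V (h \<otimes> c)" "E h = E g" "F h = F g"
    by (simp_all add: even_flag_def odd_flag_def)
  from *(2) show False
    using E_eq[OF assms(2,1)] V_c_ne[OF assms(2)] F_c_ne[OF assms(2)] *(1,3) by auto
qed

lemma inj_even_flag: "inj_on even_flag (carrier G)"
  by (rule inj_onI) (auto simp: even_flag_def intro: pivot_unique)

lemma inj_odd_flag: "inj_on odd_flag (carrier G)"
proof (rule inj_onI)
  fix g h assume "g \<in> carrier G" "h \<in> carrier G" "odd_flag g = odd_flag h"
  then show "g = h"
    using E_eq[of g h] F_c_ne[of g] by (auto simp: odd_flag_def)
qed

lemma flag_classes_disjoint: "even_flag ` carrier G \<inter> odd_flag ` carrier G = {}"
proof (rule equals0I)
  fix \<Phi> assume "\<Phi> \<in> even_flag ` carrier G \<inter> odd_flag ` carrier G"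
  then obtain g h where "g \<in> carrier G" "h \<in> carrier G" "\<Phi> = even_flag g" "\<Phi> = odd_flag h"
    by auto
  then show False
    using even_flag_ne_odd_flag[of g h] by simp
qed

lemma card_flags_poset: "finite (flags poset)" "card (flags poset) = 2 * p * q"
  using finite_carrier card_carrier flag_classes_disjoint inj_even_flag inj_odd_flag
  by (simp_all add: flags_poset card_Un_disjoint card_image)

lemma adj_flag_class:
  assumes "\<Phi> \<in> flags poset" "i \<in> {0, 1, 2}"
  shows "\<Phi> \<in> even_flag ` carrier G \<longleftrightarrow> adj_flag poset i \<Phi> \<in> odd_flag ` carrier G"
proof -
  let ?\<Psi> = "adj_flag poset i \<Phi>"
  have \<Psi>: "?\<Psi> \<in> flags poset \<and> differ_exactly_at i \<Phi> ?\<Psi>"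
    unfolding adj_flag_def by (rule theI') (rule ex1_adj_flag[OF polyhedron_poset assms])
  show ?thesis
  proof
    assume "\<Phi> \<in> even_flag ` carrier G"
    then obtain g where g: "g \<in> carrier G" "\<Phi> = even_flag g"
      by auto
    have "?\<Psi> \<notin> even_flag ` carrier G"
    proof
      assume "?\<Psi> \<in> even_flag ` carrier G"
      then obtain h where "h \<in> carrier G" "?\<Psi> = even_flag h"
        by auto
      then show False
        using \<Psi> even_flags_not_adjacent[OF g(1), of h i] g(2) assms(2) by simp
    qed
    then show "?\<Psi> \<in> odd_flag ` carrier G"
      using \<Psi> by (simp add: flags_poset)
  next
    assume "?\<Psi> \<in> odd_flag ` carrier G"
    then obtain h where h: "h \<in> carrier G" "?\<Psi> = odd_flag h"
      by auto
    have "\<Phi> \<notin> odd_flag ` carrier G"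
    proof
      assume "\<Phi> \<in> odd_flag ` carrier G"
      then obtain g where "g \<in> carrier G" "\<Phi> = odd_flag g"
        by auto
      then show False
        using \<Psi> odd_flags_not_adjacent[of g h i] h assms(2) by simp
    qed
    then show "\<Phi> \<in> even_flag ` carrier G"
      using assms(1) by (simp add: flags_poset)
  qed
qed

section \<open>Left translations as automorphisms\<close>

definition left_translation :: "'a \<Rightarrow> nat \<Rightarrow> nat" where
  "left_translation h x =
     (if x mod 3 = 0 then V (h \<otimes> inv_into (carrier G) V x)
      else if x mod 3 = 1 then E (h \<otimes> inv_into (carrier G) E x)
      else F (h \<otimes> inv_into (carrier G) F x))"

lemma left_label_eq:
  fixes i :: nat
  assumes h: "h \<in> carrier G" and g: "g \<in> carrier G"
  shows "V (h \<otimes> (g \<otimes> b [^] i)) = V (h \<otimes> g)" "E (h \<otimes> (g \<otimes> c)) = E (h \<otimes> g)"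
    "F (h \<otimes> (g \<otimes> a [^] i)) = F (h \<otimes> g)"
  using assms by (simp_all add: m_assoc[symmetric] V_b_pow F_a_pow)

text \<open>Left multiplication carries left cosets to left cosets, so the representative chosen by
  \<open>inv_into\<close> does not affect the label.\<close>

lemma left_translation_simps:
  assumes h: "h \<in> carrier G" and g: "g \<in> carrier G"
  shows "left_translation h (V g) = V (h \<otimes> g)" "left_translation h (E g) = E (h \<otimes> g)"
    "left_translation h (F g) = F (h \<otimes> g)"
proof -
  let ?v = "inv_into (carrier G) V (V g)" and ?e = "inv_into (carrier G) E (E g)"
    and ?f = "inv_into (carrier G) F (F g)"
  have c: "?v \<in> carrier G" "?e \<in> carrier G" "?f \<in> carrier G"
    using g by (auto intro: inv_into_into)
  have "V g = V ?v" "E g = E ?e" "F g = F ?f"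
    using g by (simp_all add: f_inv_into_f)
  then have "V (h \<otimes> g) = V (h \<otimes> ?v)" "E (h \<otimes> g) = E (h \<otimes> ?e)" "F (h \<otimes> g) = F (h \<otimes> ?f)"
    using V_eq[OF g c(1)] E_eq[OF g c(2)] F_eq[OF g c(3)] left_label_eq[OF h g] by metis+
  then show "left_translation h (V g) = V (h \<otimes> g)" "left_translation h (E g) = E (h \<otimes> g)"
    "left_translation h (F g) = F (h \<otimes> g)"
    using V_mod[of g] E_mod[of g] F_mod[of g] unfolding left_translation_def by simp_all
qed

lemma left_translation_inv:
  assumes "h \<in> carrier G" "x \<in> elems poset"
  shows "left_translation (inv h) (left_translation h x) = x"
    and "left_translation h (left_translation (inv h) x) = x"
    and "left_translation h x \<in> elems poset"
  using assms by (auto simp: elems_poset left_translation_simps inv_cancel_left)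

lemma left_translation_incident:
  assumes h: "h \<in> carrier G" and "incident poset x y"
  shows "incident poset (left_translation h x) (left_translation h y)"
proof -
  have *: "incident poset (left_translation h x) (left_translation h y)"
    if "(x, y) \<in> leq poset" "x \<noteq> y" for x y
    using that h incident_poset[of "h \<otimes> _"] by (auto simp: leq_poset left_translation_simps)
  then show ?thesis
    using assms(2) incident_sym[OF *[of y x]] by (auto simp: incident_def)
qed

lemma automorphism_left_translation:
  assumes h: "h \<in> carrier G"
  shows "automorphism poset (left_translation h)"
  unfolding automorphism_def
proof (intro conjI ballI)
  show "bij_betw (left_translation h) (elems poset) (elems poset)"
    using left_translation_inv h left_translation_inv(3)[of "inv h"]
    by (intro bij_betw_byWitness[where f' = "left_translation (inv h)"]) auto
  show "rk poset (left_translation h x) = rk poset x" if "x \<in> elems poset" for x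
    using that h unfolding elems_poset rk_poset
    by (elim UnE imageE) (simp_all only: left_translation_simps V_mod E_mod F_mod)
  show "incident poset (left_translation h x) (left_translation h y) \<longleftrightarrow> incident poset x y"
    if "x \<in> elems poset" "y \<in> elems poset" for x y
    using that h left_translation_incident[of h x y] left_translation_inv(1)[OF h]
      left_translation_incident[of "inv h" "left_translation h x" "left_translation h y"]
    by auto
qed

lemma aut_transitive_on_flag_class:
  "aut_transitive_on poset (even_flag ` carrier G)" "aut_transitive_on poset (odd_flag ` carrier G)"
proof -
  have "map_flag (left_translation (k \<otimes> inv g)) (even_flag g) = even_flag k"
    "map_flag (left_translation (k \<otimes> inv g)) (odd_flag g) = odd_flag k"
    if "g \<in> carrier G" "k \<in> carrier G" for g k
    using that by (simp_all add: map_flag_def even_flag_def odd_flag_def left_translation_simps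
        m_assoc inv_cancel_left)
  then show "aut_transitive_on poset (even_flag ` carrier G)"
    "aut_transitive_on poset (odd_flag ` carrier G)"
    unfolding aut_transitive_on_def
    by (blast intro: automorphism_left_translation)+
qed

section \<open>Absence of reflections\<close>

lemma reflection_step:
  assumes \<theta>: "automorphism poset \<theta>" and g: "g \<in> carrier G" and k: "k \<in> carrier G"
    and flag: "map_flag \<theta> (even_flag g) = odd_flag k"
  shows "map_flag \<theta> (even_flag (g \<otimes> a)) = odd_flag (k \<otimes> inv a)"
    and "map_flag \<theta> (even_flag (g \<otimes> b)) = odd_flag (k \<otimes> (a \<otimes> (a \<otimes> b)))"
proof -
  have Vg: "\<theta> (V g) = V (k \<otimes> c)" and Eg: "\<theta> (E g) = E k" and Fg: "\<theta> (F g) = F k"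
    using flag by (simp_all add: map_flag_def even_flag_def odd_flag_def)
  have rank: "\<theta> x \<in> of_rank poset n" if "x \<in> of_rank poset n" for x n
    using that \<theta> unfolding automorphism_def bij_betw_def of_rank_def by auto
  have inc: "incident poset (\<theta> x) (\<theta> y)" if "incident poset x y" for x y
    using that \<theta> by (auto simp: automorphism_def incident_def)
  have ne: "\<theta> x \<noteq> \<theta> y" if "x \<in> elems poset" "y \<in> elems poset" "x \<noteq> y" for x y
    using that \<theta> unfolding automorphism_def bij_betw_def by (metis inj_onD)
  have in_elems: "V x \<in> elems poset" "E x \<in> elems poset" "F x \<in> elems poset"
    and ranks: "V x \<in> vertices poset" "E x \<in> edges poset" "F x \<in> faces poset"
    if "x \<in> carrier G" for x
    using that by (auto simp: elems_poset of_rank_poset)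
  have ga: "g \<otimes> a \<in> carrier G" "g \<otimes> b \<in> carrier G" "g \<otimes> c \<in> carrier G"
    and ka: "k \<otimes> a \<in> carrier G" "k \<otimes> inv a \<in> carrier G"
    using g k by simp_all

  \<comment> \<open>The even flag of \<open>g \<otimes> a\<close> arises from that of
    \<open>g\<close> by passing to the other end of the edge and then to the other edge at that
    vertex and face. The automorphism carries both passages to the odd flag of \<open>k\<close>,
    where the first leads from \<open>V (k \<otimes> c)\<close> to \<open>V k\<close> and the second
    from \<open>E k\<close> to \<open>E (k \<otimes> b)\<close>.\<close>
  have "\<theta> (V (g \<otimes> c)) \<in> {v \<in> vertices poset. incident poset v (E k)}"
    using rank[OF ranks(1)[OF ga(3)]] inc[of "V (g \<otimes> c)" "E g"] g ga Eg by (simp add: incident_VE)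
  moreover have "\<theta> (V (g \<otimes> c)) \<noteq> V (k \<otimes> c)"
    using ne[OF in_elems(1)[OF ga(3)] in_elems(1)[OF g] V_c_ne[OF g]] Vg by simp
  ultimately have Vga: "\<theta> (V (g \<otimes> a)) = V k"
    unfolding vertices_on_edge[OF k] using V_c[OF g] by simp
  have "\<theta> (E (g \<otimes> a)) \<in> {e \<in> edges poset. incident poset (V k) e \<and> incident poset e (F k)}"
    using rank[OF ranks(2)[OF ga(1)]] inc[OF incident_poset(1)[OF ga(1)]]
      inc[OF incident_poset(2)[OF ga(1)]] Vga Fg g by simp
  moreover have "\<theta> (E (g \<otimes> a)) \<noteq> E k"
    using ne[OF in_elems(2)[OF ga(1)] in_elems(2)[OF g] E_a_ne[OF g]] Eg by simp
  ultimately have Ega: "\<theta> (E (g \<otimes> a)) = E (k \<otimes> b)"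
    unfolding edges_at_pivot[OF k] by simp
  have Ekb: "E (k \<otimes> inv a) = E (k \<otimes> b)"
    using E_c[of "k \<otimes> b"] k by (simp add: m_assoc b_c)
  have "k \<otimes> inv a \<otimes> c = k \<otimes> b"
    using k by (simp add: c_def m_assoc inv_cancel_left)
  then have "V (k \<otimes> inv a \<otimes> c) = V k"
    using k by simp
  then show "map_flag \<theta> (even_flag (g \<otimes> a)) = odd_flag (k \<otimes> inv a)"
    using Vga Ega Ekb Fg g k by (simp add: map_flag_def even_flag_def odd_flag_def)

  \<comment> \<open>The even flag of \<open>g \<otimes> b\<close> arises by passing to the other
    edge at the same vertex and face and then to the other face on that edge. On the image side the
    vertex \<open>V (k \<otimes> c)\<close> and the face \<open>F k\<close> have the pivot
    \<open>k \<otimes> a\<close>.\<close>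
  have "incident poset (E (g \<otimes> b)) (F g)"
    using g by (simp add: incident_EF F_b_c)
  then have "\<theta> (E (g \<otimes> b)) \<in>
      {e \<in> edges poset. incident poset (V (k \<otimes> a)) e \<and> incident poset e (F (k \<otimes> a))}"
    using rank[OF ranks(2)[OF ga(2)]] inc[OF incident_poset(1)[OF ga(2)]] inc[of "E (g \<otimes> b)" "F g"]
      Vg Fg g k by (simp add: V_c)
  moreover have "\<theta> (E (g \<otimes> b)) \<noteq> E k"
    using ne[OF in_elems(2)[OF ga(2)] in_elems(2)[OF g] E_b_ne[OF g]] Eg by simp
  moreover have "E (k \<otimes> a \<otimes> b) = E k"
    using E_c[OF k] k by (simp add: c_def m_assoc)
  ultimately have Egb: "\<theta> (E (g \<otimes> b)) = E (k \<otimes> a)"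
    unfolding edges_at_pivot[OF ka(1)] by simp
  have "\<theta> (F (g \<otimes> b)) \<in> {f \<in> faces poset. incident poset (E (k \<otimes> a)) f}"
    using rank[OF ranks(3)[OF ga(2)]] inc[OF incident_poset(2)[OF ga(2)]] Egb by simp
  moreover have "\<theta> (F (g \<otimes> b)) \<noteq> F k"
    using ne[OF in_elems(3)[OF ga(2)] in_elems(3)[OF g]] F_c_ne[OF ga(2)] F_b_c[OF g] Fg by simp
  ultimately have Fgb: "\<theta> (F (g \<otimes> b)) = F (k \<otimes> a \<otimes> c)"
    unfolding faces_on_edge[OF ka(1)] using k by simp
  have eq: "k \<otimes> (a \<otimes> (a \<otimes> b)) = k \<otimes> a \<otimes> c"
    using k by (simp add: c_def m_assoc)
  show "map_flag \<theta> (even_flag (g \<otimes> b)) = odd_flag (k \<otimes> (a \<otimes> (a \<otimes> b)))"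
    unfolding eq using Vg Egb Fgb g k c_cancel_right[OF ka(1)] V_c[OF k]
    by (simp add: map_flag_def even_flag_def odd_flag_def)
qed

lemma not_flag_transitive: "\<not> aut_transitive_on poset (flags poset)"
proof
  assume "aut_transitive_on poset (flags poset)"
  moreover have "even_flag \<one> \<in> flags poset" "odd_flag \<one> \<in> flags poset"
    by (auto simp: flags_poset)
  ultimately obtain \<theta> where \<theta>: "automorphism poset \<theta>" "map_flag \<theta> (even_flag \<one>) = odd_flag \<one>"
    unfolding aut_transitive_on_def by meson
  \<comment> \<open>\<open>R\<close> is the graph of a function, since an odd flag determines its
    group element; this function turns out to be the endomorphism excluded by
    \<open>no_reflection\<close>.\<close>
  define R where "R g k \<longleftrightarrow> g \<in> carrier G \<and> k \<in> carrier G \<and> map_flag \<theta> (even_flag g) = odd_flag k"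
    for g k
  let ?d = "a \<otimes> (a \<otimes> b)"
  have R_one: "R \<one> \<one>"
    using \<theta> by (simp add: R_def)
  have R_b: "R (g \<otimes> b [^] j) (k \<otimes> ?d [^] j)" if "R g k" for g k and j :: nat
  proof (induction j)
    case (Suc j)
    then show ?case
      using reflection_step(2)[OF \<theta>(1), of "g \<otimes> b [^] j" "k \<otimes> ?d [^] j"] that
      by (simp add: R_def m_assoc)
  qed (use that in \<open>simp add: R_def\<close>)
  have R_a: "R (g \<otimes> a [^] i) (k \<otimes> inv a [^] i)" if "R g k" for g k and i :: nat
  proof (induction i)
    case (Suc i)
    then show ?case
      using reflection_step(1)[OF \<theta>(1), of "g \<otimes> a [^] i" "k \<otimes> inv a [^] i"] that
      by (simp add: R_def m_assoc)
  qed (use that in \<open>simp add: R_def\<close>)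
  have R_unique: "k = k'" if "R g k" "R g k'" for g k k'
    using that inj_odd_flag by (auto simp: R_def inj_on_def)
  \<comment> \<open>The factor \<open>y\<close> depends on \<open>x\<close> alone and not on the
    pair \<open>g\<close>, \<open>k\<close>; this makes the function multiplicative.\<close>
  have R_mult: "\<exists>y. R x y \<and> (\<forall>g k. R g k \<longrightarrow> R (g \<otimes> x) (k \<otimes> y))" if x: "x \<in> carrier G" for x
  proof -
    obtain i j :: nat where ij: "x = b [^] j \<otimes> a [^] i"
      using b_pow_a_pow[OF x] by metis
    have *: "R (g \<otimes> x) (k \<otimes> (?d [^] j \<otimes> inv a [^] i))" if "R g k" for g k
      using R_a[OF R_b[OF that]] that ij by (simp add: R_def m_assoc)
    moreover have "R x (?d [^] j \<otimes> inv a [^] i)"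
      using *[OF R_one] x by simp
    ultimately show ?thesis by blast
  qed
  define \<rho> where "\<rho> x = (SOME y. R x y)" for x
  have R_\<rho>: "R x (\<rho> x)" if "x \<in> carrier G" for x
    unfolding \<rho>_def using R_mult[OF that] by (auto intro: someI_ex)
  have \<rho>_eq: "\<rho> x = y" if "R x y" for x y
    using R_unique[OF R_\<rho> that] that by (simp add: R_def)
  have "\<rho> \<in> hom G G"
  proof (rule homI)
    fix x assume "x \<in> carrier G"
    then show "\<rho> x \<in> carrier G"
      using R_\<rho> by (simp add: R_def)
  next
    fix x y assume x: "x \<in> carrier G" and y: "y \<in> carrier G"
    obtain z where z: "R y z" "\<forall>g k. R g k \<longrightarrow> R (g \<otimes> y) (k \<otimes> z)"
      using R_mult[OF y] by blast
    then show "\<rho> (x \<otimes> y) = \<rho> x \<otimes> \<rho> y"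
      using \<rho>_eq[OF z(1)] \<rho>_eq[of "x \<otimes> y" "\<rho> x \<otimes> z"] R_\<rho>[OF x] by simp
  qed
  moreover have "\<rho> a = inv a" "\<rho> b = ?d"
    using R_a[OF R_one, of 1] R_b[OF R_one, of 1] by (simp_all add: \<rho>_eq)
  ultimately show False
    by (rule no_reflection)
qed

lemma chiral_poset: "chiral poset"
  unfolding chiral_def
proof (intro conjI exI ballI)
  show "even_flag ` carrier G \<union> odd_flag ` carrier G = flags poset"
    by (simp add: flags_poset)
qed (use flag_classes_disjoint adj_flag_class aut_transitive_on_flag_class not_flag_transitive
  in auto)

lemma tight_poset: "tight_of_type poset p q"
  by (simp add: tight_of_type_def has_type_poset card_flags_poset)

end

section \<open>Natural numbers as labels\<close>

lemma (in tight_chiral_group) exists_polyhedron: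
  "\<exists>P :: nat ranked_poset. polyhedron P \<and> chiral P \<and> tight_of_type P p q"
proof -
  obtain n :: "'a set \<Rightarrow> nat" where n: "inj_on n (Pow (carrier G))"
    using finite_carrier finite_imp_inj_to_nat_seg[of "Pow (carrier G)"] by auto
  let ?coset = "\<lambda>x g. {g \<otimes> x [^] i |i :: nat. True}"
  have coset_eq: "?coset x g = ?coset x h \<longleftrightarrow> (\<exists>i :: nat. h = g \<otimes> x [^] i)"
    if x: "x \<in> carrier G" "x [^] N = \<one>" "N > 1" and g: "g \<in> carrier G" and h: "h \<in> carrier G"
    for x g h and N :: nat
  proof
    assume "?coset x g = ?coset x h"
    moreover have "h \<in> ?coset x h"
      using h by (auto intro!: exI[of _ "0 :: nat"])
    ultimately show "\<exists>i :: nat. h = g \<otimes> x [^] i"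
      by auto
  next
    assume "\<exists>i :: nat. h = g \<otimes> x [^] i"
    then obtain i :: nat where i: "h = g \<otimes> x [^] i" ..
    show "?coset x g = ?coset x h"
    proof (intro equalityI subsetI)
      fix y assume "y \<in> ?coset x h"
      then obtain j :: nat where "y = h \<otimes> x [^] j" by auto
      then have "y = g \<otimes> x [^] (i + j)"
        using i x g by (simp add: m_assoc nat_pow_mult)
      then show "y \<in> ?coset x g" by blast
    next
      fix y assume "y \<in> ?coset x g"
      then obtain j :: nat where j: "y = g \<otimes> x [^] j" by auto
      \<comment> \<open>Since \<open>x [^] N = \<one>\<close>, the \<open>(N - 1) * i\<close>
        additional factors undo \<open>x [^] i\<close>, so natural exponents suffice.\<close>
      have "x [^] (i + ((N - 1) * i + j)) = x [^] j"
      proof -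
        have "i + ((N - 1) * i + j) = N * i + j"
          using x(3) by (cases N) auto
        moreover have "x [^] (N * i + j) = x [^] j"
          using x nat_pow_mult[of x "N * i" j] by (simp add: nat_pow_pow[symmetric])
        ultimately show ?thesis
          by (simp only:)
      qed
      then have "y = h \<otimes> x [^] ((N - 1) * i + j)"
        using i j x g by (simp add: m_assoc nat_pow_mult)
      then show "y \<in> ?coset x h" by blast
    qed
  qed
  have n_eq: "n A = n B \<longleftrightarrow> A = B" if "A \<subseteq> carrier G" "B \<subseteq> carrier G" for A B
    using n that by (auto simp: inj_on_def)
  have coset_subset: "?coset x g \<subseteq> carrier G" if "x \<in> carrier G" "g \<in> carrier G" for x g
    using that by auto
  \<comment> \<open>\<open>n\<close> numbers the subsets of the finite carrier; tripling it leaves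
    the residue modulo 3 free to record the rank.\<close>
  define V where "V g = 3 * n (?coset b g)" for g
  define E where "E g = 3 * n {g, g \<otimes> c} + 1" for g
  define F where "F g = 3 * n (?coset a g) + 2" for g
  interpret labelled_tight_chiral_group G a b p q V E F
  proof
    show "V g mod 3 = 0" "E g mod 3 = 1" "F g mod 3 = 2" for g
      unfolding V_def E_def F_def by presburger+
    fix g h assume g: "g \<in> carrier G" and h: "h \<in> carrier G"
    show "V g = V h \<longleftrightarrow> (\<exists>j :: nat. h = g \<otimes> b [^] j)"
      using n_eq[OF coset_subset[OF b_closed g] coset_subset[OF b_closed h]]
        coset_eq[OF b_closed b_pow q_gt_1 g h] by (simp add: V_def)
    show "F g = F h \<longleftrightarrow> (\<exists>i :: nat. h = g \<otimes> a [^] i)"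
      using n_eq[OF coset_subset[OF a_closed g] coset_subset[OF a_closed h]]
        coset_eq[OF a_closed a_pow p_gt_1 g h] by (simp add: F_def)
    have "{g, g \<otimes> c} = {h, h \<otimes> c} \<longleftrightarrow> h = g \<or> h = g \<otimes> c"
      using g h by (auto simp: doubleton_eq_iff m_assoc)
    then show "E g = E h \<longleftrightarrow> h = g \<or> h = g \<otimes> c"
      using n_eq[of "{g, g \<otimes> c}" "{h, h \<otimes> c}"] g h by (simp add: E_def)
  qed
  show ?thesis
    using polyhedron_poset chiral_poset tight_poset by blast
qed

section \<open>A family of tight chiral groups\<close>

text \<open>The sign \<open>(-1)^x\<close> for an exponent that may be negative.\<close>

definition sgn_pow :: "int \<Rightarrow> int" where
  "sgn_pow x = (if even x then 1 else - 1)"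

lemma sgn_pow_simps [simp]: "sgn_pow 0 = 1" "sgn_pow 1 = - 1" "sgn_pow (- x) = sgn_pow x"
  by (simp_all add: sgn_pow_def)

lemma sgn_pow_add: "sgn_pow (x + y) = sgn_pow x * sgn_pow y"
  by (simp add: sgn_pow_def)

lemma sgn_pow_cong: "even (x - y) \<Longrightarrow> sgn_pow x = sgn_pow y"
  by (auto simp: sgn_pow_def)

lemma odd_sgn_pow: "odd (sgn_pow x)"
  by (simp add: sgn_pow_def)

lemma dvd_mult_diff:
  fixes n :: int
  assumes "n dvd a - a'" "n dvd b - b'"
  shows "n dvd a * b - a' * b'"
proof -
  have "a * b - a' * b' = (a - a') * b + a' * (b - b')" by (simp add: algebra_simps)
  then show ?thesis using assms by simp
qed

text \<open>Here \<open>m * t\<close> is the modulus \<open>Q\<close>. The condition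
  \<open>sign_compatible\<close> makes \<open>sgn_pow y\<close> meaningful modulo \<open>P\<close>
  although \<open>y\<close> is only known modulo \<open>Q\<close>: for even \<open>t\<close>
  congruent values have equal parity, and modulo 2 signs are irrelevant. Coprimality puts
  \<open>(1, 0, 0)\<close> among the powers of \<open>(1, 1, 0)\<close>.\<close>

locale triple_group =
  fixes M P m t :: int
  assumes M_pos: "M > 0" and P_pos: "P > 0" and t_pos: "t > 0"
    and prime_m: "prime m" and odd_m: "odd m"
    and m_dvd_M: "m dvd M" and m_dvd_t: "m dvd t" and M_dvd_Q: "M dvd m * t"
    and even_P: "even P" and coprime_M_P: "coprime M P"
    and sign_compatible: "P = 2 \<or> even t"
begin

type_synonym triple = "int \<times> int \<times> int"

definition equiv_triple :: "triple \<Rightarrow> triple \<Rightarrow> bool" (infix "\<approx>" 50) where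
  "g \<approx> h \<longleftrightarrow> (case (g, h) of ((u, x, y), (u', x', y')) \<Rightarrow>
     M dvd u - u' \<and> P dvd x - x' \<and> m * t dvd y - y')"

text \<open>Defined on unreduced integer triples: by \<open>reduce_mult\<close>, calculations can be
  done here and reduced once at the end.\<close>

definition mul :: "triple \<Rightarrow> triple \<Rightarrow> triple" where
  "mul g h = (case (g, h) of ((u, x, y), (u', x', y')) \<Rightarrow>
     (u + u', x + sgn_pow y * x', y + sgn_pow x * (1 + u * t) * y'))"

definition reduce :: "triple \<Rightarrow> triple" where
  "reduce g = (case g of (u, x, y) \<Rightarrow> (u mod M, x mod P, y mod (m * t)))"

definition G :: "triple monoid" where
  "G = \<lparr>carrier = {0..<M} \<times> {0..<P} \<times> {0..<m * t}, mult = (\<lambda>g h. reduce (mul g h)), one = (0, 0, 0)\<rparr>"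

section \<open>The group axioms\<close>

lemma m_pos: "m > 0"
  using prime_m by (simp add: prime_gt_0_int)

lemma reduce_equiv: "reduce g \<approx> g"
  by (cases g) (auto simp: equiv_triple_def reduce_def dvd_diff_commute minus_mod_eq_mult_div)

lemma reduce_eq_iff: "reduce g = reduce h \<longleftrightarrow> g \<approx> h"
  by (cases g; cases h) (auto simp: equiv_triple_def reduce_def mod_eq_dvd_iff)

lemma reduce_carrier: "reduce g \<in> carrier G"
  using M_pos P_pos m_pos t_pos by (cases g) (auto simp: G_def reduce_def)

lemma reduce_id: "g \<in> carrier G \<Longrightarrow> reduce g = g"
  by (auto simp: G_def reduce_def)

lemma reduce_zero: "reduce (0, 0, 0) = (0, 0, 0)"
  by (simp add: reduce_def)

lemma sgn_pow_cong_P: "m * t dvd y - y' \<Longrightarrow> P dvd (sgn_pow y - sgn_pow y') * x"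
proof (cases "P = 2")
  case True
  then show ?thesis using odd_sgn_pow by simp
next
  case False
  then have "even t" using sign_compatible by simp
  moreover assume "m * t dvd y - y'"
  ultimately have "even (y - y')" by (meson dvd_mult dvd_trans)
  then have "sgn_pow y = sgn_pow y'" by (rule sgn_pow_cong)
  then show ?thesis by simp
qed

lemma mul_cong:
  assumes "g \<approx> g'" "h \<approx> h'"
  shows "mul g h \<approx> mul g' h'"
proof -
  obtain u x y u' x' y' where g: "g = (u, x, y)" "g' = (u', x', y')" by (cases g; cases g')
  obtain v z w v' z' w' where h: "h = (v, z, w)" "h' = (v', z', w')" by (cases h; cases h')
  have d: "M dvd u - u'" "P dvd x - x'" "m * t dvd y - y'" "M dvd v - v'" "P dvd z - z'" "m * t dvd w - w'"
    using assms unfolding g h by (auto simp: equiv_triple_def)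
  have 1: "M dvd (u + v) - (u' + v')"
    using dvd_add[OF d(1,4)] by (simp add: algebra_simps)
  have "sgn_pow y * z - sgn_pow y' * z' = (sgn_pow y - sgn_pow y') * z + sgn_pow y' * (z - z')"
    by (simp add: algebra_simps)
  then have "P dvd sgn_pow y * z - sgn_pow y' * z'"
    using sgn_pow_cong_P[OF d(3), of z] d(5) by simp
  then have 2: "P dvd (x + sgn_pow y * z) - (x' + sgn_pow y' * z')"
    using dvd_add[OF d(2), of "sgn_pow y * z - sgn_pow y' * z'"] by (simp add: algebra_simps)
  have s: "sgn_pow x = sgn_pow x'"
    using d(2) even_P by (intro sgn_pow_cong) (meson dvd_trans)
  \<comment> \<open>Modulo \<open>m * t\<close> the factor \<open>1 + u * t\<close> depends only on
    \<open>u\<close> modulo \<open>m\<close>, and \<open>m\<close> divides \<open>M\<close>.\<close>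
  have "m dvd u - u'"
    using d(1) m_dvd_M by (meson dvd_trans)
  then have "m * t dvd (1 + u * t) - (1 + u' * t)"
    using mult_dvd_mono[of m "u - u'" t t] by (simp add: algebra_simps)
  then have "m * t dvd (1 + u * t) * w - (1 + u' * t) * w'"
    using d(6) by (rule dvd_mult_diff)
  then have "m * t dvd sgn_pow x * ((1 + u * t) * w - (1 + u' * t) * w')"
    by simp
  then have 3: "m * t dvd (y + sgn_pow x * (1 + u * t) * w) - (y' + sgn_pow x' * (1 + u' * t) * w')"
    unfolding s using dvd_add[OF d(3), of "sgn_pow x' * ((1 + u * t) * w - (1 + u' * t) * w')"]
    by (simp add: algebra_simps)
  show ?thesis
    unfolding g h equiv_triple_def mul_def using 1 2 3 by simp
qed

lemma mul_assoc: "mul (mul g h) k \<approx> mul g (mul h k)"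
proof -
  obtain u x y where g: "g = (u, x, y)" by (cases g)
  obtain u' x' y' where h: "h = (u', x', y')" by (cases h)
  obtain u'' x'' y'' where k: "k = (u'', x'', y'')" by (cases k)
  have "P dvd (sgn_pow (y + sgn_pow x * (1 + u * t) * y') - sgn_pow y * sgn_pow y') * x''"
  proof (cases "P = 2")
    case False
    then have "even t" using sign_compatible by simp
    then have "sgn_pow (y + sgn_pow x * (1 + u * t) * y') = sgn_pow (y + y')"
      using odd_sgn_pow by (intro sgn_pow_cong) simp
    then have "sgn_pow (y + sgn_pow x * (1 + u * t) * y') = sgn_pow y * sgn_pow y'"
      by (simp only: sgn_pow_add)
    then show ?thesis by (simp only: diff_self) simp
  qed (use odd_sgn_pow in simp)
  then have 1: "P dvd (x + sgn_pow y * x' + sgn_pow (y + sgn_pow x * (1 + u * t) * y') * x'') -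
      (x + sgn_pow y * (x' + sgn_pow y' * x''))"
    by (simp add: algebra_simps)
  have s: "sgn_pow (x + sgn_pow y * x') = sgn_pow x * sgn_pow x'"
    unfolding sgn_pow_add[symmetric] using odd_sgn_pow by (intro sgn_pow_cong) simp
  \<comment> \<open>The product of the factors \<open>1 + u * t\<close> and
    \<open>1 + u' * t\<close> is \<open>1 + (u + u') * t\<close> up to a multiple of
    \<open>t * t\<close>, which vanishes because \<open>m\<close> divides \<open>t\<close>.\<close>
  have "(y + sgn_pow x * (1 + u * t) * y' + sgn_pow (x + sgn_pow y * x') * (1 + (u + u') * t) * y'') -
      (y + sgn_pow x * (1 + u * t) * (y' + sgn_pow x' * (1 + u' * t) * y'')) =
      - (sgn_pow x * sgn_pow x' * u * u' * y'' * t * t)"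
    unfolding s by (simp add: algebra_simps)
  moreover have "m * t dvd - (sgn_pow x * sgn_pow x' * u * u' * y'' * t * t)"
    using m_dvd_t by (simp add: mult_dvd_mono)
  ultimately show ?thesis
    unfolding g h k equiv_triple_def mul_def using 1 by (simp add: add.assoc)
qed

lemma mult_G: "g \<otimes>\<^bsub>G\<^esub> h = reduce (mul g h)" and one_G: "\<one>\<^bsub>G\<^esub> = (0, 0, 0)"
  by (simp_all add: G_def)

lemma reduce_mult: "reduce g \<otimes>\<^bsub>G\<^esub> reduce h = reduce (mul g h)"
  unfolding mult_G reduce_eq_iff by (intro mul_cong reduce_equiv)

lemma group_G: "group G"
proof (rule groupI)
  fix g h k assume *: "g \<in> carrier G" "h \<in> carrier G" "k \<in> carrier G"
  have "g \<otimes>\<^bsub>G\<^esub> h \<otimes>\<^bsub>G\<^esub> k = reduce (mul (mul g h) k)"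
    using reduce_mult[of "mul g h" k] *(3) by (simp add: mult_G[of g h] reduce_id)
  also have "\<dots> = reduce (mul g (mul h k))"
    unfolding reduce_eq_iff by (rule mul_assoc)
  also have "\<dots> = g \<otimes>\<^bsub>G\<^esub> (h \<otimes>\<^bsub>G\<^esub> k)"
    using reduce_mult[of g "mul h k"] *(1) by (simp add: mult_G[of h k] reduce_id)
  finally show "g \<otimes>\<^bsub>G\<^esub> h \<otimes>\<^bsub>G\<^esub> k = g \<otimes>\<^bsub>G\<^esub> (h \<otimes>\<^bsub>G\<^esub> k)" .
next
  fix g assume "g \<in> carrier G"
  then show "\<one>\<^bsub>G\<^esub> \<otimes>\<^bsub>G\<^esub> g = g"
    using reduce_id[of g] by (cases g) (simp add: mult_G one_G mul_def)
next
  fix g assume g: "g \<in> carrier G"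
  obtain u x y where uxy: "g = (u, x, y)" by (cases g)
  \<comment> \<open>The third entry is chosen to cancel exactly, as \<open>?h\<close> acts on
    \<open>y\<close> by the sign of \<open>x\<close> and the factor \<open>1 - u * t\<close>. For
    even \<open>t\<close> it has the parity of \<open>y\<close>, as the second entry
    requires.\<close>
  let ?h = "(- u, - (sgn_pow y * x), - (sgn_pow x * (1 - u * t) * y))"
  have s: "sgn_pow (sgn_pow y * x) = sgn_pow x"
    using odd_sgn_pow by (intro sgn_pow_cong) simp
  have "P dvd (sgn_pow (- (sgn_pow x * (1 - u * t) * y)) - sgn_pow y) * x"
  proof (cases "P = 2")
    case False
    then have "even t" using sign_compatible by simp
    then have "sgn_pow (- (sgn_pow x * (1 - u * t) * y)) = sgn_pow y"
      using odd_sgn_pow by (intro sgn_pow_cong) simp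
    then show ?thesis by simp
  qed (use odd_sgn_pow in simp)
  then have "mul ?h g \<approx> (0, 0, 0)"
    unfolding uxy equiv_triple_def mul_def by (simp add: s left_diff_distrib)
  then have "reduce ?h \<otimes>\<^bsub>G\<^esub> g = \<one>\<^bsub>G\<^esub>"
    using reduce_mult[of ?h g] reduce_eq_iff[of "mul ?h g" "(0, 0, 0)"] reduce_zero
    unfolding reduce_id[OF g] one_G by (simp only:)
  then show "\<exists>h \<in> carrier G. h \<otimes>\<^bsub>G\<^esub> g = \<one>\<^bsub>G\<^esub>"
    using reduce_carrier by blast
qed (auto simp: mult_G reduce_carrier one_G, use M_pos P_pos m_pos t_pos in \<open>simp add: G_def\<close>)

interpretation group G
  by (rule group_G)

section \<open>Generators and their powers\<close>

definition gen_a :: triple where "gen_a = reduce (1, 1, 0)"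

definition gen_b :: triple where "gen_b = reduce (- 1, 0, 1)"

text \<open>The triangular number \<open>j (j - 1) / 2\<close>. It collects the corrections
  \<open>- j * t\<close> that the first entry \<open>- j\<close> of a power of \<open>gen_b\<close>
  causes at the next multiplication.\<close>

definition below_sum :: "nat \<Rightarrow> int" where "below_sum j = (\<Sum>i<j. int i)"

lemma below_sum_Suc [simp]: "below_sum 0 = 0" "below_sum (Suc j) = below_sum j + int j"
  by (simp_all add: below_sum_def)

lemma double_below_sum: "2 * below_sum j = int j * (int j - 1)"
  by (induction j) (auto simp: algebra_simps)

text \<open>As \<open>m\<close> is odd, the factor 2 in \<open>double_below_sum\<close> can be
  cancelled.\<close>

lemma m_dvd_below_sum:
  assumes "m dvd int j"
  shows "m dvd below_sum j"
proof -
  have "m dvd 2 * below_sum j"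
    unfolding double_below_sum using assms by simp
  moreover have "coprime m 2"
    using odd_m by simp
  ultimately show ?thesis
    by (simp add: coprime_dvd_mult_right_iff)
qed

lemma reduce_eqI:
  assumes "M dvd u - u'" "P dvd x - x'" "m * t dvd y - y'"
  shows "reduce (u, x, y) = reduce (u', x', y')"
  using assms by (simp add: reduce_eq_iff equiv_triple_def)

lemma reduce_mult_triple: "reduce (u, x, y) \<otimes>\<^bsub>G\<^esub> reduce (u', x', y') =
    reduce (u + u', x + sgn_pow y * x', y + sgn_pow x * (1 + u * t) * y')"
  by (simp add: reduce_mult mul_def)

lemma one_G_reduce: "\<one>\<^bsub>G\<^esub> = reduce (0, 0, 0)"
  by (simp add: one_G reduce_zero)

lemma gen_a_pow: "gen_a [^]\<^bsub>G\<^esub> (i :: nat) = reduce (int i, int i, 0)"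
  by (induction i) (simp_all add: one_G_reduce gen_a_def reduce_mult_triple add.commute)

lemma gen_b_pow: "gen_b [^]\<^bsub>G\<^esub> (j :: nat) = reduce (- int j, 0, int j - t * below_sum j)"
  by (induction j) (simp_all add: one_G_reduce gen_b_def reduce_mult_triple algebra_simps)

lemma sign_cases:
  obtains "P = 2" | "P \<noteq> 2" "even t"
  using sign_compatible by auto

lemma gen_a_b: "gen_a \<otimes>\<^bsub>G\<^esub> gen_b = reduce (0, 1, - (1 + t))"
  by (simp add: gen_a_def gen_b_def reduce_mult_triple)

lemma gen_a_a_b: "gen_a \<otimes>\<^bsub>G\<^esub> (gen_a \<otimes>\<^bsub>G\<^esub> gen_b) = reduce (1, 2, (1 + t)\<^sup>2)"
  unfolding gen_a_b by (simp add: gen_a_def reduce_mult_triple power2_eq_square algebra_simps)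

lemma gen_a_b_involution:
  "(gen_a \<otimes>\<^bsub>G\<^esub> gen_b) \<otimes>\<^bsub>G\<^esub> (gen_a \<otimes>\<^bsub>G\<^esub> gen_b) = \<one>\<^bsub>G\<^esub>"
proof -
  \<comment> \<open>The second entry of the square: it is zero when \<open>t\<close> is even, since
    then \<open>1 + t\<close> is odd, and it is even in any case.\<close>
  have "P dvd 1 + sgn_pow (- (1 + t))"
    by (rule sign_cases) (auto simp: sgn_pow_def)
  then show ?thesis
    unfolding gen_a_b reduce_mult_triple one_G_reduce by (intro reduce_eqI) simp_all
qed

text \<open>The second entry stays even and so leaves the third unsigned. For even \<open>t\<close>
  the third entry changes parity at each step, so the second alternates between 0 and 2; for
  \<open>P = 2\<close> both values vanish.\<close>

lemma gen_a_a_b_pow: "reduce (1, 2, (1 + t)\<^sup>2) [^]\<^bsub>G\<^esub> (j :: nat) =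
    reduce (int j, if even j then 0 else 2, (1 + t)\<^sup>2 * (int j + t * below_sum j))"
proof (induction j)
  case 0
  then show ?case by (simp add: one_G_reduce)
next
  case (Suc j)
  let ?e = "\<lambda>j. if even j then 0 else 2 :: int" and ?y = "(1 + t)\<^sup>2 * (int j + t * below_sum j)"
  have "P dvd ?e j + sgn_pow ?y * 2 - ?e (Suc j)"
    by (rule sign_cases) (auto simp: sgn_pow_def)
  moreover have "sgn_pow (?e j) = 1"
    by (simp add: sgn_pow_def)
  moreover have "?y + (1 + int j * t) * (1 + t)\<^sup>2 =
      (1 + t)\<^sup>2 * (int (Suc j) + t * below_sum (Suc j))"
    by (simp add: algebra_simps)
  ultimately show ?case
    unfolding nat_pow_Suc Suc.IH reduce_mult_triple by (intro reduce_eqI) simp_all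
qed

lemma gen_b_pow_t: "gen_b [^]\<^bsub>G\<^esub> nat t = reduce (- t, 0, t)"
proof -
  have "m dvd below_sum (nat t)"
    using m_dvd_t t_pos by (intro m_dvd_below_sum) simp
  then show ?thesis
    unfolding gen_b_pow using t_pos by (intro reduce_eqI) (simp_all add: mult.commute)
qed

text \<open>The corrections are multiples of \<open>m * t\<close>, since \<open>m\<close> divides
  \<open>t\<close> and hence \<open>below_sum (nat t)\<close>. Together with
  \<open>gen_b_pow_t\<close> this shows that a reflection would fix
  \<open>(0, 0, t)\<close>.\<close>

lemma gen_a_a_b_pow_t: "reduce (1, 2, (1 + t)\<^sup>2) [^]\<^bsub>G\<^esub> nat t = reduce (t, 0, t)"
proof -
  have m: "m dvd below_sum (nat t)"
    using m_dvd_t t_pos by (intro m_dvd_below_sum) simp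
  have "(1 + t)\<^sup>2 * (t + t * below_sum (nat t)) - t =
      t * (t * (2 + t) + (1 + t)\<^sup>2 * below_sum (nat t))"
    by (simp add: power2_eq_square algebra_simps)
  moreover have "m dvd t * (2 + t) + (1 + t)\<^sup>2 * below_sum (nat t)"
    using m m_dvd_t by (intro dvd_add) auto
  ultimately have "m * t dvd (1 + t)\<^sup>2 * (t + t * below_sum (nat t)) - t"
    by (simp add: mult.commute)
  moreover have "P dvd (if even (nat t) then 0 else 2)"
    using t_pos by (rule_tac sign_cases) (auto simp: even_nat_iff)
  ultimately show ?thesis
    unfolding gen_a_a_b_pow using t_pos by (intro reduce_eqI) simp_all
qed

lemma gen_a_pow_eq_gen_b_pow:
  fixes i j :: nat
  assumes "gen_a [^]\<^bsub>G\<^esub> i = gen_b [^]\<^bsub>G\<^esub> j"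
  shows "M * P dvd int i" "m * t dvd int j"
proof -
  have d: "M dvd int i + int j" "P dvd int i" "m * t dvd int j - t * below_sum j"
    using assms unfolding gen_a_pow gen_b_pow reduce_eq_iff equiv_triple_def
    by (auto simp: dvd_diff_commute)
  \<comment> \<open>The third entry is used twice. Modulo \<open>t\<close> the correction drops out,
    so \<open>t\<close> divides \<open>j\<close>; then \<open>m\<close> divides
    \<open>below_sum j\<close>, and the correction drops out modulo \<open>m * t\<close> as
    well.\<close>
  from d(3) have "t dvd int j - t * below_sum j"
    by (rule dvd_mult_right)
  then have "t dvd int j"
    using dvd_add[of t "int j - t * below_sum j" "t * below_sum j"] by simp
  then have "m dvd below_sum j"
    using m_dvd_t by (intro m_dvd_below_sum) (rule dvd_trans)
  then have "m * t dvd t * below_sum j"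
    by (simp add: mult.commute)
  with d(3) show j: "m * t dvd int j"
    using dvd_add[of "m * t" "int j - t * below_sum j" "t * below_sum j"] by simp
  then have "M dvd int j"
    using M_dvd_Q by (meson dvd_trans)
  then have "M dvd int i"
    using d(1) by (simp add: dvd_add_left_iff)
  then show "M * P dvd int i"
    using d(2) coprime_M_P by (simp add: divides_mult)
qed

lemma gen_a_pow_order: "gen_a [^]\<^bsub>G\<^esub> nat (M * P) = \<one>\<^bsub>G\<^esub>"
  unfolding gen_a_pow one_G_reduce using M_pos P_pos by (intro reduce_eqI) simp_all

lemma gen_b_pow_order: "gen_b [^]\<^bsub>G\<^esub> nat (m * t) = \<one>\<^bsub>G\<^esub>"
proof -
  let ?Q = "m * t"
  have Q: "int (nat ?Q) = ?Q"
    using m_pos t_pos by simp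
  have "m dvd below_sum (nat ?Q)"
    by (rule m_dvd_below_sum) (simp add: Q)
  then have "?Q dvd t * below_sum (nat ?Q)"
    by (simp add: mult.commute)
  then have "?Q dvd ?Q - t * below_sum (nat ?Q)"
    by simp
  then show ?thesis
    unfolding gen_b_pow one_G_reduce Q using M_dvd_Q by (intro reduce_eqI) simp_all
qed

section \<open>Exclusion of reflections in the family\<close>

lemma gen_a_power_first:
  obtains i :: nat where "gen_a [^]\<^bsub>G\<^esub> i = reduce (1, 0, 0)"
proof -
  obtain u v where uv: "u * M + v * P = 1"
    using bezout_int[of M P] coprime_M_P by (auto simp: coprime_iff_gcd_eq_1)
  \<comment> \<open>A solution of the congruences 0 modulo \<open>P\<close> and 1 modulo
    \<open>M\<close>; taking \<open>v mod M\<close> keeps the exponent non-negative.\<close>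
  define i where "i = nat (P * (v mod M))"
  have "int i = P * (v - M * (v div M))"
    unfolding i_def using M_pos P_pos by (simp add: minus_mult_div_eq_mod)
  moreover from this have "int i - 1 = M * (- u - P * (v div M))"
    using uv by (simp add: algebra_simps)
  ultimately have "P dvd int i" "M dvd int i - 1"
    by (metis dvd_triv_left)+
  then have "gen_a [^]\<^bsub>G\<^esub> i = reduce (1, 0, 0)"
    unfolding gen_a_pow by (intro reduce_eqI) simp_all
  then show thesis by (rule that)
qed

lemma no_reflection:
  assumes hom: "\<rho> \<in> hom G G" and a: "\<rho> gen_a = inv\<^bsub>G\<^esub> gen_a"
    and b: "\<rho> gen_b = gen_a \<otimes>\<^bsub>G\<^esub> (gen_a \<otimes>\<^bsub>G\<^esub> gen_b)"
  shows False
proof -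
  interpret \<rho>: group_hom G G \<rho>
    using hom by unfold_locales
  have closed: "gen_a \<in> carrier G" "gen_b \<in> carrier G" "reduce g \<in> carrier G" for g
    by (simp_all add: gen_a_def gen_b_def reduce_carrier)
  define u where "u = reduce (1, 0, 0)"
  define u' where "u' = reduce (- 1, 0, 0)"
  define d where "d = reduce (1, 2, (1 + t)\<^sup>2)"
  define z where "z = reduce (0, 0, t)"
  obtain i :: nat where i: "gen_a [^]\<^bsub>G\<^esub> i = u"
    unfolding u_def by (rule gen_a_power_first)
  have u_closed: "u \<in> carrier G" "u' \<in> carrier G" "z \<in> carrier G" "d \<in> carrier G"
    by (simp_all add: u_def u'_def z_def d_def closed)
  have "u' \<otimes>\<^bsub>G\<^esub> u = \<one>\<^bsub>G\<^esub>"
    by (simp add: u_def u'_def reduce_mult_triple one_G_reduce)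
  then have "inv\<^bsub>G\<^esub> u = u'"
    using u_closed by (intro inv_equality) simp_all
  moreover have "\<rho> u = inv\<^bsub>G\<^esub> u"
    using \<rho>.hom_nat_pow[OF closed(1), of i] a i nat_pow_inv[OF closed(1), of i] by simp
  ultimately have \<rho>_u: "\<rho> u = u'"
    by simp
  have \<rho>_b: "\<rho> gen_b = d"
    using b by (simp add: gen_a_a_b d_def)
  have u_pow: "u [^]\<^bsub>G\<^esub> j = reduce (int j, 0, 0)" "u' [^]\<^bsub>G\<^esub> j = reduce (- int j, 0, 0)" for j :: nat
    by (induction j) (simp_all add: one_G_reduce u_def u'_def reduce_mult_triple add.commute)
  \<comment> \<open>The cubic error term stems from the factors \<open>1 + t * t\<close> and
    \<open>1 - t * t\<close> by which the powers of \<open>u\<close> and \<open>u'\<close> with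
    exponent \<open>nat t\<close> act on the third entry.\<close>
  have mt: "m * t dvd t * t * t"
    using m_dvd_t by (simp add: mult_dvd_mono)
  \<comment> \<open>Written as a product of powers of \<open>u\<close> and \<open>gen_b\<close>,
    \<open>z\<close> has a known image, which turns out to be \<open>z\<close> itself.\<close>
  have "u [^]\<^bsub>G\<^esub> nat t \<otimes>\<^bsub>G\<^esub> gen_b [^]\<^bsub>G\<^esub> nat t = z"
    unfolding u_pow gen_b_pow_t reduce_mult_triple z_def
    using t_pos mt by (intro reduce_eqI) (simp_all add: algebra_simps)
  then have "\<rho> z = u' [^]\<^bsub>G\<^esub> nat t \<otimes>\<^bsub>G\<^esub> d [^]\<^bsub>G\<^esub> nat t"
    using \<rho>_u \<rho>_b u_closed closed \<rho>.hom_mult[of "u [^]\<^bsub>G\<^esub> nat t" "gen_b [^]\<^bsub>G\<^esub> nat t"]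
      \<rho>.hom_nat_pow[of u "nat t"] \<rho>.hom_nat_pow[of gen_b "nat t"] by simp
  also have "\<dots> = z"
    unfolding u_pow d_def gen_a_a_b_pow_t reduce_mult_triple z_def
    using t_pos mt by (intro reduce_eqI) (simp_all add: algebra_simps)
  finally have \<rho>_z: "\<rho> z = z" .
  \<comment> \<open>\<open>z\<close> is the commutator of \<open>u\<close> and \<open>gen_b\<close>.
    Applying \<open>\<rho>\<close> to this relation and comparing third entries leaves
    \<open>2 * t\<close> up to multiples of \<open>m * t\<close>.\<close>
  have "u \<otimes>\<^bsub>G\<^esub> gen_b = z \<otimes>\<^bsub>G\<^esub> (gen_b \<otimes>\<^bsub>G\<^esub> u)"
    by (simp add: u_def z_def gen_b_def reduce_mult_triple add.commute)
  then have "\<rho> u \<otimes>\<^bsub>G\<^esub> \<rho> gen_b = \<rho> z \<otimes>\<^bsub>G\<^esub> (\<rho> gen_b \<otimes>\<^bsub>G\<^esub> \<rho> u)"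
    using u_closed closed by (metis \<rho>.hom_mult m_closed)
  then have "u' \<otimes>\<^bsub>G\<^esub> d = z \<otimes>\<^bsub>G\<^esub> (d \<otimes>\<^bsub>G\<^esub> u')"
    by (simp add: \<rho>_u \<rho>_b \<rho>_z)
  then have "m * t dvd (1 - t) * (1 + t)\<^sup>2 - (t + (1 + t)\<^sup>2)"
    by (simp add: u'_def d_def z_def reduce_mult_triple reduce_eq_iff equiv_triple_def)
  also have "(1 - t) * (1 + t)\<^sup>2 - (t + (1 + t)\<^sup>2) = - ((t * (2 + t) + 2) * t)"
    by (simp add: power2_eq_square algebra_simps)
  finally have "m * t dvd (t * (2 + t) + 2) * t"
    by (simp only: dvd_minus_iff)
  then have "m dvd t * (2 + t) + 2"
    using t_pos by simp
  then have "m dvd 2"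
    using m_dvd_t by (simp add: dvd_add_right_iff)
  then have "m \<le> 2"
    by (rule zdvd_imp_le) simp
  moreover have "m > 1"
    using prime_m by (rule prime_gt_1_int)
  ultimately show False
    using odd_m by (cases "m = 2") auto
qed

lemma card_carrier_G: "finite (carrier G)" "card (carrier G) = nat (M * P) * nat (m * t)"
  using M_pos P_pos m_pos t_pos by (simp_all add: G_def card_cartesian_product nat_mult_distrib)

end

lemma (in triple_group) tight_chiral_group_G:
  "tight_chiral_group G gen_a gen_b (nat (M * P)) (nat (m * t))"
proof -
  interpret group G
    by (rule group_G)
  have "m \<le> M"
    using m_dvd_M M_pos by (rule zdvd_imp_le)
  moreover have "m > 1"
    using prime_m by (simp add: prime_gt_1_int)
  moreover have "m * 1 \<le> m * t" "M * 1 \<le> M * P"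
    using m_pos t_pos M_pos P_pos by (intro mult_left_mono; simp)+
  ultimately have gt: "m * t > 1" "M * P > 1"
    by linarith+
  show ?thesis
  proof
    fix i j :: nat assume "gen_a [^]\<^bsub>G\<^esub> i = gen_b [^]\<^bsub>G\<^esub> j"
    from gen_a_pow_eq_gen_b_pow[OF this] show "nat (M * P) dvd i \<and> nat (m * t) dvd j"
      using gt by (simp add: nat_dvd_iff)
  qed (use gt card_carrier_G gen_a_pow_order gen_b_pow_order gen_a_b_involution no_reflection
      in \<open>auto simp: gen_a_def gen_b_def reduce_carrier\<close>)
qed

section \<open>Choice of the parameters\<close>

lemma exists_tight_chiral_group:
  fixes m M P Q :: nat
  assumes "prime m" "odd m" "M > 0" "P > 0" "Q > 0" "m dvd M" "M dvd Q" "m\<^sup>2 dvd Q"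
    and "even P" "coprime M P" "P = 2 \<or> even Q"
  shows "\<exists>(G :: (int \<times> int \<times> int) monoid) a b. tight_chiral_group G a b (M * P) Q"
proof -
  obtain t where t: "Q = m * t"
    using dvd_mult_left[of m m Q] assms(8) by (auto simp: power2_eq_square)
  have "m > 0"
    using assms(1) by (simp add: prime_gt_0_nat)
  then have m_dvd_t: "m dvd t"
    using assms(8) by (simp add: t power2_eq_square)
  interpret triple_group "int M" "int P" "int m" "int t"
    using assms m_dvd_t by unfold_locales (auto simp: t simp flip: of_nat_mult)
  have "tight_chiral_group G gen_a gen_b (M * P) Q"
    using tight_chiral_group_G by (simp add: t nat_mult_distrib)
  then show ?thesis
    by blast
qed

theorem theorem3p13:
  fixes m r s :: nat
  assumes "prime m" and "odd m" and "r > 0" and "s > 0"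
    and "even s \<or> (odd s \<and> r dvd s * m)"
  shows "\<exists>P :: nat ranked_poset.
    polyhedron P \<and> chiral P \<and> tight_of_type P (2 * r * m) (s * m\<^sup>2)"
proof -
  have m0: "m > 0"
    using assms(1) by (simp add: prime_gt_0_nat)
  have "\<exists>(G :: (int \<times> int \<times> int) monoid) a b. tight_chiral_group G a b (2 * r * m) (s * m\<^sup>2)"
    using assms(5)
  proof (elim disjE conjE)
    assume s: "odd s" "r dvd s * m"
    \<comment> \<open>\<open>r * m\<close> serves as \<open>M\<close> and 2 as \<open>P\<close>;
      they are coprime because \<open>r\<close> divides the odd number \<open>s * m\<close>.\<close>
    then have "odd (r * m)"
      using assms(2) by (metis dvd_trans even_mult_iff)
    moreover have "r * m dvd s * m\<^sup>2"
      using s(2) by (simp add: power2_eq_square mult.assoc[symmetric])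
    ultimately have "\<exists>(G :: (int \<times> int \<times> int) monoid) a b. tight_chiral_group G a b (r * m * 2) (s * m\<^sup>2)"
      using assms m0 by (intro exists_tight_chiral_group[of m]) auto
    then show ?thesis
      by (simp add: ac_simps)
  next
    assume s: "even s"
    have p: "\<not> is_unit m"
      using assms(1) not_prime_unit by blast
    define k where "k = multiplicity m r"
    define l where "l = multiplicity m s"
    obtain r' where r': "r = m ^ k * r'" "\<not> m dvd r'"
      using multiplicity_decompose'[of r m] assms(3) p unfolding k_def by auto
    obtain s' where s': "s = m ^ l * s'" "\<not> m dvd s'"
      using multiplicity_decompose'[of s m] assms(4) p unfolding l_def by auto
    have cop: "coprime (m ^ n) (2 * r')" "coprime (m ^ n) s'" for n
      using assms(1,2) r'(2) s'(2) by (auto intro!: coprime_power_left_iff[THEN iffD2] simp: prime_imp_coprime)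
    have s'_even: "even s'"
      using s assms(2) by (simp add: s'(1))
    \<comment> \<open>The largest powers of \<open>m\<close> dividing \<open>r * m\<close> and
      \<open>s * m\<^sup>2\<close> have exponents \<open>k + 1\<close> and \<open>l + 2\<close>. The
      smaller power becomes \<open>M\<close>, and its cofactor, \<open>2 * r'\<close> or
      \<open>s'\<close>, becomes \<open>P\<close>.\<close>
    show ?thesis
    proof (cases "k + 1 \<le> l + 2")
      case True
      then have "m ^ (k + 1) dvd m ^ (l + 2)"
        by (rule le_imp_power_dvd)
      then have "m ^ (k + 1) dvd s * m\<^sup>2"
        unfolding s'(1) by (metis dvd_mult2 mult.assoc mult.commute power_add)
      then have "\<exists>(G :: (int \<times> int \<times> int) monoid) a b.
          tight_chiral_group G a b (m ^ (k + 1) * (2 * r')) (s * m\<^sup>2)"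
        using assms m0 s cop(1)[of "k + 1"] r' by (intro exists_tight_chiral_group[of m]) auto
      moreover have "m ^ (k + 1) * (2 * r') = 2 * r * m"
        by (simp add: r'(1) ac_simps)
      ultimately show ?thesis
        by (simp only:)
    next
      case False
      then have "m ^ (l + 2) dvd m ^ (k + 1)" "m\<^sup>2 dvd m ^ (k + 1)"
        by (auto intro!: le_imp_power_dvd simp del: power_Suc)
      moreover have Q: "2 * r * m = m ^ (k + 1) * (2 * r')"
        by (simp add: r'(1) ac_simps)
      ultimately have "m ^ (l + 2) dvd 2 * r * m" "m\<^sup>2 dvd 2 * r * m"
        unfolding Q by (meson dvd_mult2)+
      then have "\<exists>(G :: (int \<times> int \<times> int) monoid) a b.
          tight_chiral_group G a b (m ^ (l + 2) * s') (2 * r * m)"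
        using assms m0 s'_even cop(2)[of "l + 2"] s' by (intro exists_tight_chiral_group[of m]) auto
      moreover have "m ^ (l + 2) * s' = s * m\<^sup>2"
          by (simp add: s'(1) power_add power2_eq_square ac_simps)
      ultimately obtain G :: "(int \<times> int \<times> int) monoid" and a b
        where "tight_chiral_group G a b (s * m\<^sup>2) (2 * r * m)"
        by (metis (no_types))
      \<comment> \<open>The two orders have come out exchanged, which passing to the dual generators
        repairs.\<close>
      then show ?thesis
        by (intro exI) (rule tight_chiral_group.dual)
    qed
  qed
  then obtain G :: "(int \<times> int \<times> int) monoid" and a b
    where "tight_chiral_group G a b (2 * r * m) (s * m\<^sup>2)"
    by blast
  then show ?thesis
    by (rule tight_chiral_group.exists_polyhedron)
qed

end
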